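(* Let $L$ be a $\kappa$-frame. There is an injective frame homomorphism $\iota:\mathbb{C}L\hookrightarrow\mathbb{C}(\mathcal{H}_\kappa L)$ such that, furthermore, for every congruence $C\in\mathbb{C}L$, $\mathcal{H}_\kappa(L/C)\cong\mathcal{H}_\kappa L/\iota(C)$ and the quotient map $\mathcal{H}_\kappa L\to\mathcal{H}_\kappa L/\iota(C)$ is $\kappa$-proper.
   Context: Here $\kappa$ is either an infinite regular cardinal or the symbol $\infty$. A $\kappa$-set is a set of cardinality less than $\kappa$ (any set if $\kappa=\infty$). A $\kappa$-frame is a bounded distributive lattice with joins of all $\kappa$-sets, over which binary meets distribute; for $\kappa=\infty$ this is a frame. For a $\kappa$-frame $L$, $\mathbb{C}L$ denotes the frame of all $\kappa$-frame congruences on $L$ (equivalence relations closed under finite meets and $\kappa$-joins in $L\times L$), ordered by inclusion. $\mathcal{H}_\kappa L$ is the frame of $\kappa$-ideals of $L$ (downsets closed under $\kappa$-joins; principal ideals if $\kappa=\infty$) ordered by inclusion; it is the free frame on the $\kappa$-frame $L$. $\mathbb{C}(\mathcal{H}_\kappa L)$ is the frame of frame congruences on the frame $\mathcal{H}_\kappa L$ (closed under finite meets and arbitrary joins). The map $\iota$ is the one given by sending $C$ to the frame congruence generated by $\{(\downarrow a,\downarrow b)\mid(a,b)\in C\}$. An element $a$ of a frame is $\kappa$-Lindelöf if every family with join $\ge a$ has a subfamily indexed by a $\kappa$-set with join $\ge a$. A frame homomorphism between $\kappa$-coherent frames is $\kappa$-proper if it maps $\kappa$-Lindelöf elements to $\kappa$-Lindelöf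 elements, where a frame is $\kappa$-coherent if its $\kappa$-Lindelöf elements form a sub-$\kappa$-frame generating it under arbitrary joins; equivalently, if it is isomorphic to $\mathcal{H}_\kappa N$ for some $\kappa$-frame $N$. *)

theory Defs
  imports "HOL-Algebra.Complete_Lattice"
begin

unbundle cardinal_syntax

text \<open>
  The parameter \<open>\<kappa>\<close> is \<open>Some r\<close> for an infinite regular cardinal \<open>r\<close>
  (given, as in \<^theory>\<open>Main\<close>, as a cardinal order on some type), or \<open>None\<close>, which stands
  for the symbol \<open>\<infinity>\<close>.
\<close>

definition regular_or_infty :: "'k rel option \<Rightarrow> bool" where
  "regular_or_infty \<kappa> \<longleftrightarrow> (case \<kappa> of None \<Rightarrow> True | Some r \<Rightarrow> Cinfinite r \<and> regularCard r)"

definition kappa_set :: "'k rel option \<Rightarrow> 'a set \<Rightarrow> bool" where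
  "kappa_set \<kappa> A \<longleftrightarrow> (case \<kappa> of None \<Rightarrow> True | Some r \<Rightarrow> |A| <o r)"

locale kappa_frame = bounded_lattice L for \<kappa> :: "'k rel option" and L (structure) +
  assumes meet_join_distrib:
      "\<lbrakk>x \<in> carrier L; y \<in> carrier L; z \<in> carrier L\<rbrakk>
        \<Longrightarrow> x \<sqinter> (y \<squnion> z) = (x \<sqinter> y) \<squnion> (x \<sqinter> z)"
    and kappa_sup_exists:
      "\<lbrakk>A \<subseteq> carrier L; kappa_set \<kappa> A\<rbrakk> \<Longrightarrow> \<exists>s. least L s (Upper L A)"
    and meet_kappa_sup_distrib:
      "\<lbrakk>x \<in> carrier L; A \<subseteq> carrier L; kappa_set \<kappa> A\<rbrakk>
        \<Longrightarrow> x \<sqinter> (\<Squnion> A) = \<Squnion> ((\<lambda>a. x \<sqinter> a) ` A)"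

text \<open>The type \<open>nat\<close> below is a dummy: \<open>None\<close> carries no cardinal.\<close>

abbreviation infty :: "nat rel option" where
  "infty \<equiv> None"

abbreviation frame :: "('a, 'b) gorder_scheme \<Rightarrow> bool" where
  "frame \<equiv> kappa_frame infty"

definition frame_hom ::
    "('a, 'c) gorder_scheme \<Rightarrow> ('b, 'd) gorder_scheme \<Rightarrow> ('a \<Rightarrow> 'b) \<Rightarrow> bool" where
  "frame_hom A B f \<longleftrightarrow>
     frame A \<and> frame B \<and> f \<in> carrier A \<rightarrow> carrier B \<and>
     f \<top>\<^bsub>A\<^esub> = \<top>\<^bsub>B\<^esub> \<and> meet_pres A B f \<and> sup_pres A B f"

definition frame_isomorphic ::
    "('a, 'c) gorder_scheme \<Rightarrow> ('b, 'd) gorder_scheme \<Rightarrow> bool" where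
  "frame_isomorphic A B \<longleftrightarrow> (\<exists>f. frame_hom A B f \<and> bij_betw f (carrier A) (carrier B))"

text \<open>
  A congruence is an equivalence relation on \<open>L\<close> closed under finite meets (top element and
  binary meets) and \<open>\<kappa>\<close>-joins, all computed componentwise in \<open>L \<times> L\<close>.
\<close>

definition kappa_congruence :: "'k rel option \<Rightarrow> ('a, 'b) gorder_scheme \<Rightarrow> 'a rel \<Rightarrow> bool" where
  "kappa_congruence \<kappa> L C \<longleftrightarrow>
     equiv (carrier L) C \<and>
     (\<top>\<^bsub>L\<^esub>, \<top>\<^bsub>L\<^esub>) \<in> C \<and>
     (\<forall>a b c d. (a, b) \<in> C \<longrightarrow> (c, d) \<in> C \<longrightarrow> (a \<sqinter>\<^bsub>L\<^esub> c, b \<sqinter>\<^bsub>L\<^esub> d) \<in> C) \<and>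
     (\<forall>S \<subseteq> C. kappa_set \<kappa> S \<longrightarrow> (\<Squnion>\<^bsub>L\<^esub> (fst ` S), \<Squnion>\<^bsub>L\<^esub> (snd ` S)) \<in> C)"

definition congruence_frame ::
    "'k rel option \<Rightarrow> ('a, 'b) gorder_scheme \<Rightarrow> 'a rel gorder" where
  "congruence_frame \<kappa> L =
     \<lparr>carrier = {C. kappa_congruence \<kappa> L C}, eq = (=), le = (\<subseteq>)\<rparr>"

definition generated_frame_congruence :: "('a, 'b) gorder_scheme \<Rightarrow> 'a rel \<Rightarrow> 'a rel" where
  "generated_frame_congruence L R = \<Inter> {D. kappa_congruence infty L D \<and> R \<subseteq> D}"

text \<open>
  The order of \<open>L/C\<close> is the one of its meet operation \<open>[a] \<sqinter> [b] = [a \<sqinter> b]\<close>: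
  \<open>[a] \<sqsubseteq> [b]\<close> iff \<open>[a \<sqinter> b] = [a]\<close>.
\<close>

definition quotient_lattice :: "('a, 'b) gorder_scheme \<Rightarrow> 'a rel \<Rightarrow> 'a set gorder" where
  "quotient_lattice L C =
     \<lparr>carrier = carrier L // C, eq = (=),
      le = (\<lambda>X Y. \<forall>a\<in>X. \<forall>b\<in>Y. a \<sqinter>\<^bsub>L\<^esub> b \<in> X)\<rparr>"

definition quotient_map :: "'a rel \<Rightarrow> 'a \<Rightarrow> 'a set" where
  "quotient_map C a = C `` {a}"

definition principal :: "('a, 'b) gorder_scheme \<Rightarrow> 'a \<Rightarrow> 'a set" where
  "principal L a = {x \<in> carrier L. x \<sqsubseteq>\<^bsub>L\<^esub> a}"

text \<open>
  For \<open>\<kappa> = \<infinity>\<close> a \<open>\<kappa>\<close>-ideal contains its own join, so the \<open>\<kappa>\<close>-ideals are then exactly the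
  principal ideals.
\<close>

definition kappa_ideal :: "'k rel option \<Rightarrow> ('a, 'b) gorder_scheme \<Rightarrow> 'a set \<Rightarrow> bool" where
  "kappa_ideal \<kappa> L I \<longleftrightarrow>
     I \<subseteq> carrier L \<and>
     (\<forall>x\<in>I. \<forall>y\<in>carrier L. y \<sqsubseteq>\<^bsub>L\<^esub> x \<longrightarrow> y \<in> I) \<and>
     (\<forall>S \<subseteq> I. kappa_set \<kappa> S \<longrightarrow> \<Squnion>\<^bsub>L\<^esub> S \<in> I)"

definition ideal_frame :: "'k rel option \<Rightarrow> ('a, 'b) gorder_scheme \<Rightarrow> 'a set gorder" where
  "ideal_frame \<kappa> L = \<lparr>carrier = {I. kappa_ideal \<kappa> L I}, eq = (=), le = (\<subseteq>)\<rparr>"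

definition kappa_Lindelof :: "'k rel option \<Rightarrow> ('a, 'b) gorder_scheme \<Rightarrow> 'a \<Rightarrow> bool" where
  "kappa_Lindelof \<kappa> A a \<longleftrightarrow>
     a \<in> carrier A \<and>
     (\<forall>S \<subseteq> carrier A. a \<sqsubseteq>\<^bsub>A\<^esub> \<Squnion>\<^bsub>A\<^esub> S \<longrightarrow>
        (\<exists>T \<subseteq> S. kappa_set \<kappa> T \<and> a \<sqsubseteq>\<^bsub>A\<^esub> \<Squnion>\<^bsub>A\<^esub> T))"

definition sub_kappa_frame :: "'k rel option \<Rightarrow> 'a set \<Rightarrow> ('a, 'b) gorder_scheme \<Rightarrow> bool" where
  "sub_kappa_frame \<kappa> K A \<longleftrightarrow>
     K \<subseteq> carrier A \<and> \<top>\<^bsub>A\<^esub> \<in> K \<and>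
     (\<forall>x\<in>K. \<forall>y\<in>K. x \<sqinter>\<^bsub>A\<^esub> y \<in> K) \<and>
     (\<forall>S \<subseteq> K. kappa_set \<kappa> S \<longrightarrow> \<Squnion>\<^bsub>A\<^esub> S \<in> K)"

definition kappa_coherent :: "'k rel option \<Rightarrow> ('a, 'b) gorder_scheme \<Rightarrow> bool" where
  "kappa_coherent \<kappa> A \<longleftrightarrow>
     frame A \<and>
     sub_kappa_frame \<kappa> {a. kappa_Lindelof \<kappa> A a} A \<and>
     (\<forall>a\<in>carrier A. \<exists>S \<subseteq> {k. kappa_Lindelof \<kappa> A k}. a = \<Squnion>\<^bsub>A\<^esub> S)"

definition kappa_proper ::
    "'k rel option \<Rightarrow> ('a, 'c) gorder_scheme \<Rightarrow> ('b, 'd) gorder_scheme \<Rightarrow> ('a \<Rightarrow> 'b) \<Rightarrow> bool" where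
  "kappa_proper \<kappa> A B f \<longleftrightarrow>
     kappa_coherent \<kappa> A \<and> kappa_coherent \<kappa> B \<and> frame_hom A B f \<and>
     (\<forall>a. kappa_Lindelof \<kappa> A a \<longrightarrow> kappa_Lindelof \<kappa> B (f a))"

definition cong_embedding ::
    "'k rel option \<Rightarrow> ('a, 'b) gorder_scheme \<Rightarrow> 'a rel \<Rightarrow> 'a set rel" where
  "cong_embedding \<kappa> L C =
     generated_frame_congruence (ideal_frame \<kappa> L)
       {(principal L a, principal L b) | a b. (a, b) \<in> C}"

end

theory Submission
  imports Defs
begin

text \<open>
  The idea is to make \<open>\<iota>\<close> explicit. A \<open>\<kappa>\<close>-ideal \<open>I\<close> of \<open>L\<close> has an image in \<open>L/C\<close>, which is again a
  \<open>\<kappa>\<close>-ideal and is determined by the saturation \<open>C `` I\<close>. So the kernel of the induced map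
  \<open>\<H>\<^sub>\<kappa> L \<rightarrow> \<H>\<^sub>\<kappa> (L/C)\<close> is the relation \<open>C `` I = C `` J\<close>, called \<open>ideal_congruence\<close> below. It relates
  \<open>\<down>a\<close> and \<open>\<down>b\<close> exactly when \<open>(a, b) \<in> C\<close>, and it is the least frame congruence that does so for all
  pairs in \<open>C\<close>, because every ideal is the join of its principal ideals
  (\<open>ideal_congruence_least\<close>). Hence it equals \<open>\<iota>(C)\<close> (\<open>cong_embedding_eq\<close>).

  With this description the claims on \<open>\<iota>\<close> become elementary. Injectivity holds since \<open>C\<close> can be read
  off from the principal ideals. Binary meets are preserved by a computation with elements
  (\<open>ideal_congruence_Int\<close>). Joins are preserved because \<open>\<iota>\<close> has a right adjoint: a frame congruence
  \<open>D\<close> on \<open>\<H>\<^sub>\<kappa> L\<close> restricts along \<open>a \<mapsto> \<down>a\<close> to a \<open>\<kappa>\<close>-congruence on \<open>L\<close>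
  (\<open>principal_pullback_congruence\<close>).

  That \<open>\<H>\<^sub>\<kappa> L\<close> and \<open>\<C>L\<close> are frames follows from one principle: both consist of sets, closed under
  intersection and ordered by inclusion, so only distributivity is at stake, and it is enough to exhibit
  the Heyting implication. For congruences \<open>C\<close> and \<open>E\<close> it is the set of all pairs \<open>(a, b)\<close> whose
  projections to the interval from \<open>x\<close> to \<open>x \<squnion> y\<close> are related by \<open>E\<close>, for each \<open>(x, y) \<in> C\<close>
  (\<open>congruence_residual_iff\<close>).

  The isomorphism between \<open>\<H>\<^sub>\<kappa> (L/C)\<close> and \<open>\<H>\<^sub>\<kappa> L/\<iota>(C)\<close> sends an ideal \<open>X\<close> of classes to the class of
  its union, which is a saturated ideal (\<open>ideal_quotient_iso\<close>). It carries \<open>\<kappa>\<close>-coherence from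
  \<open>\<H>\<^sub>\<kappa> (L/C)\<close> to the quotient. The \<open>\<kappa>\<close>-Lindelof elements of a frame of \<open>\<kappa>\<close>-ideals are the
  principal ideals, and the class of \<open>\<down>a\<close> corresponds to the principal ideal of the class of \<open>a\<close>;
  so the quotient map is \<open>\<kappa>\<close>-proper.
\<close>

section \<open>Sets of size less than \<kappa>\<close>

lemma kappa_set_infty [simp]: "kappa_set None A"
  by (simp add: kappa_set_def)

lemma regular_or_infty_infty [simp]: "regular_or_infty None"
  by (simp add: regular_or_infty_def)

lemma kappa_set_subset: "kappa_set \<kappa> B \<Longrightarrow> A \<subseteq> B \<Longrightarrow> kappa_set \<kappa> A"
  unfolding kappa_set_def
  by (auto split: option.splits intro: ordLeq_ordLess_trans[OF card_of_mono1])

lemma kappa_set_image: "kappa_set \<kappa> A \<Longrightarrow> kappa_set \<kappa> (f ` A)"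
  unfolding kappa_set_def
  by (auto split: option.splits intro: ordLeq_ordLess_trans[OF card_of_image])

lemma kappa_set_finite:
  assumes "regular_or_infty \<kappa>" "finite A"
  shows "kappa_set \<kappa> A"
proof (cases \<kappa>)
  case (Some r)
  then have r: "Cinfinite r"
    using assms(1) by (simp add: regular_or_infty_def)
  have "|A| <o r"
  proof (rule finite_ordLess_infinite)
    show "finite (Field |A| )" using assms(2) by (simp add: Field_card_of)
    show "infinite (Field r)" using r by (simp add: cinfinite_def)
    show "Well_order r" using r card_order_on_well_order_on by blast
  qed (simp add: card_of_Well_order)
  then show ?thesis by (simp add: kappa_set_def Some)
qed simp

lemma kappa_set_UN:
  assumes "regular_or_infty \<kappa>" "kappa_set \<kappa> I" "\<And>i. i \<in> I \<Longrightarrow> kappa_set \<kappa> (A i)"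
  shows "kappa_set \<kappa> (\<Union>i\<in>I. A i)"
proof (cases \<kappa>)
  case (Some r)
  then show ?thesis
    using assms card_of_UNION_ordLess_infinite_Field_regularCard[of r I A]
    by (simp add: kappa_set_def regular_or_infty_def)
qed simp

lemma kappa_set_insert:
  assumes "regular_or_infty \<kappa>" "kappa_set \<kappa> A"
  shows "kappa_set \<kappa> (insert a A)"
proof -
  have "kappa_set \<kappa> (\<Union>b\<in>UNIV. if b then A else {a})"
    using assms by (intro kappa_set_UN) (auto intro: kappa_set_finite)
  then show ?thesis by (rule kappa_set_subset) auto
qed

section \<open>Joins, meets and \<kappa>-frames\<close>

lemma is_lub_iff:
  fixes L (structure)
  assumes "A \<subseteq> carrier L"
  shows "is_lub L s A \<longleftrightarrow>
    s \<in> carrier L \<and> (\<forall>a\<in>A. a \<sqsubseteq> s) \<and> (\<forall>u\<in>carrier L. (\<forall>a\<in>A. a \<sqsubseteq> u) \<longrightarrow> s \<sqsubseteq> u)"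
  using assms unfolding least_def Upper_def by blast

lemma is_glb_iff:
  fixes L (structure)
  assumes "A \<subseteq> carrier L"
  shows "is_glb L s A \<longleftrightarrow>
    s \<in> carrier L \<and> (\<forall>a\<in>A. s \<sqsubseteq> a) \<and> (\<forall>u\<in>carrier L. (\<forall>a\<in>A. u \<sqsubseteq> a) \<longrightarrow> u \<sqsubseteq> s)"
  using assms unfolding greatest_def Lower_def by blast

context partial_order
begin

lemma sup_eqI: "is_lub L s A \<Longrightarrow> \<Squnion>A = s"
  unfolding Lattice.sup_def by (rule some_equality) (auto intro: least_unique)

lemma inf_eqI: "is_glb L s A \<Longrightarrow> \<Sqinter>A = s"
  unfolding Lattice.inf_def by (rule some_equality) (auto intro: greatest_unique)

lemma meet_eqI: "is_glb L m {x, y} \<Longrightarrow> x \<sqinter> y = m"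
  unfolding meet_def by (rule inf_eqI)

lemma top_eqI: "t \<in> carrier L \<Longrightarrow> (\<And>x. x \<in> carrier L \<Longrightarrow> x \<sqsubseteq> t) \<Longrightarrow> \<top> = t"
  unfolding top_def
  by (rule some_equality) (auto simp: greatest_def)

end

text \<open>
  The inequality in \<open>distrib\<close> suffices, since the converse one is monotonicity. Distributivity over binary
  joins is the case of a two-element set, as finite sets are \<open>\<kappa>\<close>-sets.
\<close>

lemma kappa_frameI:
  fixes L (structure)
  assumes reg: "regular_or_infty \<kappa>"
    and po: "partial_order L"
    and top: "t \<in> carrier L" "\<And>x. x \<in> carrier L \<Longrightarrow> x \<sqsubseteq> t"
    and glb: "\<And>x y. \<lbrakk>x \<in> carrier L; y \<in> carrier L\<rbrakk> \<Longrightarrow> \<exists>m. is_glb L m {x, y}"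
    and lub: "\<And>A. \<lbrakk>A \<subseteq> carrier L; kappa_set \<kappa> A\<rbrakk> \<Longrightarrow> \<exists>s. is_lub L s A"
    and distrib: "\<And>x A s u. \<lbrakk>x \<in> carrier L; A \<subseteq> carrier L; kappa_set \<kappa> A; is_lub L s A;
        u \<in> carrier L; \<And>a. a \<in> A \<Longrightarrow> x \<sqinter> a \<sqsubseteq> u\<rbrakk> \<Longrightarrow> x \<sqinter> s \<sqsubseteq> u"
  shows "kappa_frame \<kappa> L"
proof -
  interpret partial_order L by (rule po)
  note fin = kappa_set_finite[OF reg]
  interpret bounded_lattice L
  proof
    show "\<exists>s. is_lub L s {x, y}" if "x \<in> carrier L" "y \<in> carrier L" for x y
      using lub[of "{x, y}"] that by (simp add: fin)
    show "\<exists>x. least L x (carrier L)"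
      using lub[of "{}"] by (simp add: fin)
    show "\<exists>x. greatest L x (carrier L)"
      using top by (auto simp: greatest_def)
  qed (fact glb)
  have distrib_sup: "x \<sqinter> (\<Squnion>A) = \<Squnion>((\<lambda>a. x \<sqinter> a) ` A)"
    if x: "x \<in> carrier L" and A: "A \<subseteq> carrier L" "kappa_set \<kappa> A" for x A
  proof -
    have B: "(\<lambda>a. x \<sqinter> a) ` A \<subseteq> carrier L" using x A by auto
    obtain s where s: "is_lub L s A" using lub A by blast
    obtain u where u: "is_lub L u ((\<lambda>a. x \<sqinter> a) ` A)"
      using lub[OF B kappa_set_image[OF A(2)]] by blast
    have sc: "s \<in> carrier L" and uc: "u \<in> carrier L" using s u by auto
    have "x \<sqinter> s \<sqsubseteq> u"
      using distrib[OF x A s uc] u B by (simp add: is_lub_iff)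
    moreover have "u \<sqsubseteq> x \<sqinter> s"
    proof -
      have "x \<sqinter> a \<sqsubseteq> x \<sqinter> s" if "a \<in> A" for a
      proof -
        have a: "a \<in> carrier L" "a \<sqsubseteq> s" using that A s by (auto simp: is_lub_iff)
        then show ?thesis
          using x sc by (meson le_trans meet_closed meet_le meet_left meet_right)
      qed
      then show ?thesis using u B x sc by (simp add: is_lub_iff)
    qed
    ultimately have "x \<sqinter> s = u" using x sc uc by (simp add: le_antisym)
    then show ?thesis using sup_eqI s u by simp
  qed
  show ?thesis
  proof
    show "x \<sqinter> (y \<squnion> z) = x \<sqinter> y \<squnion> x \<sqinter> z"
      if "x \<in> carrier L" "y \<in> carrier L" "z \<in> carrier L" for x y z
      using distrib_sup[of x "{y, z}"] that by (simp add: join_def fin)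
  qed (fact lub distrib_sup)+
qed

text \<open>The infimum of a set is the join of its lower bounds.\<close>

lemma frame_complete_lattice:
  assumes "frame L"
  shows "complete_lattice L"
proof -
  interpret kappa_frame infty L by (rule assms)
  show ?thesis
  proof
    show "\<exists>s. is_lub L s A" if "A \<subseteq> carrier L" for A
      using kappa_sup_exists that by simp
    show "\<exists>i. is_glb L i A" if A: "A \<subseteq> carrier L" for A
    proof -
      have c: "Lower L A \<subseteq> carrier L" by simp
      then obtain s where s: "is_lub L s (Lower L A)"
        using kappa_sup_exists by fastforce
      have "s \<sqsubseteq>\<^bsub>L\<^esub> a" if "a \<in> A" for a
      proof (rule least_le[OF s], rule Upper_memI)
        show "a \<in> carrier L" using A that by blast
        show "y \<sqsubseteq>\<^bsub>L\<^esub> a" if "y \<in> Lower L A" for y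
          using Lower_memD[OF that \<open>a \<in> A\<close> A] by blast
      qed
      moreover have "u \<sqsubseteq>\<^bsub>L\<^esub> s" if "u \<in> Lower L A" for u
        by (rule least_Upper_above[OF s that c])
      ultimately have "is_glb L s A"
        using s A by (intro greatest_LowerI) auto
      then show ?thesis ..
    qed
  qed
qed

locale regular_kappa_frame = kappa_frame \<kappa> L for \<kappa> :: "'k rel option" and L (structure) +
  assumes regular: "regular_or_infty \<kappa>"
begin

lemma finite_kappa_set [simp]: "finite A \<Longrightarrow> kappa_set \<kappa> A"
  by (rule kappa_set_finite[OF regular])

lemma sup_is_lub:
  assumes "A \<subseteq> carrier L" "kappa_set \<kappa> A"
  shows "is_lub L (\<Squnion>A) A"
  using kappa_sup_exists[OF assms] sup_eqI by auto

lemma sup_closed [simp]: "\<lbrakk>A \<subseteq> carrier L; kappa_set \<kappa> A\<rbrakk> \<Longrightarrow> \<Squnion>A \<in> carrier L"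
  using sup_is_lub by blast

lemma sup_upper: "\<lbrakk>A \<subseteq> carrier L; kappa_set \<kappa> A; a \<in> A\<rbrakk> \<Longrightarrow> a \<sqsubseteq> \<Squnion>A"
  using sup_is_lub is_lub_iff by metis

lemma sup_least:
  "\<lbrakk>A \<subseteq> carrier L; kappa_set \<kappa> A; u \<in> carrier L; \<And>a. a \<in> A \<Longrightarrow> a \<sqsubseteq> u\<rbrakk> \<Longrightarrow> \<Squnion>A \<sqsubseteq> u"
  using sup_is_lub is_lub_iff by metis

lemma sup_mono:
  "\<lbrakk>A \<subseteq> B; B \<subseteq> carrier L; kappa_set \<kappa> B\<rbrakk> \<Longrightarrow> \<Squnion>A \<sqsubseteq> \<Squnion>B"
  by (rule sup_least) (auto intro: sup_upper kappa_set_subset)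

lemma meet_sup_upper:
  "\<lbrakk>x \<in> carrier L; A \<subseteq> carrier L; kappa_set \<kappa> A; u \<in> carrier L;
    \<And>a. a \<in> A \<Longrightarrow> x \<sqinter> a \<sqsubseteq> u\<rbrakk> \<Longrightarrow> x \<sqinter> \<Squnion>A \<sqsubseteq> u"
  by (subst meet_kappa_sup_distrib) (auto intro!: sup_least kappa_set_image)

lemma meet_absorb1: "\<lbrakk>x \<in> carrier L; y \<in> carrier L; x \<sqsubseteq> y\<rbrakk> \<Longrightarrow> x \<sqinter> y = x"
  using le_iff_join by simp

lemma meet_idem: "x \<in> carrier L \<Longrightarrow> x \<sqinter> x = x"
  by (simp add: meet_absorb1)

lemma meet_join_absorb: "\<lbrakk>x \<in> carrier L; y \<in> carrier L\<rbrakk> \<Longrightarrow> x \<sqinter> (x \<squnion> y) = x"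
  by (simp add: meet_absorb1 join_left)

lemma join_meet_absorb: "\<lbrakk>x \<in> carrier L; y \<in> carrier L\<rbrakk> \<Longrightarrow> x \<squnion> (x \<sqinter> y) = x"
  by (metis join_comm le_iff_meet meet_closed meet_left)

lemma join_meet_distrib:
  assumes "x \<in> carrier L" "y \<in> carrier L" "z \<in> carrier L"
  shows "x \<squnion> (y \<sqinter> z) = (x \<squnion> y) \<sqinter> (x \<squnion> z)"
proof -
  have "(x \<squnion> y) \<sqinter> (x \<squnion> z) = ((x \<squnion> y) \<sqinter> x) \<squnion> ((x \<squnion> y) \<sqinter> z)"
    using assms by (simp add: meet_join_distrib)
  also have "(x \<squnion> y) \<sqinter> x = x"
    using assms by (metis meet_comm meet_join_absorb)
  also have "(x \<squnion> y) \<sqinter> z = (x \<sqinter> z) \<squnion> (y \<sqinter> z)"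
    using assms by (metis meet_comm meet_join_distrib)
  also have "x \<squnion> ((x \<sqinter> z) \<squnion> (y \<sqinter> z)) = x \<squnion> (y \<sqinter> z)"
    using assms by (metis join_assoc join_meet_absorb meet_closed)
  finally show ?thesis by simp
qed

end


section \<open>Frames of sets ordered by inclusion\<close>

abbreviation inclusion_order :: "'a set set \<Rightarrow> 'a set gorder" where
  "inclusion_order M \<equiv> \<lparr>carrier = M, eq = (=), le = (\<subseteq>)\<rparr>"

lemma inclusion_partial_order: "partial_order (inclusion_order M)"
  by unfold_locales auto

lemma inclusion_meet:
  "\<lbrakk>X \<in> M; Y \<in> M; X \<inter> Y \<in> M\<rbrakk> \<Longrightarrow> X \<sqinter>\<^bsub>inclusion_order M\<^esub> Y = X \<inter> Y"
  by (rule partial_order.meet_eqI[OF inclusion_partial_order]) (simp add: is_glb_iff)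

lemma inclusion_sup:
  assumes "\<A> \<subseteq> M" "S \<in> M" "\<Union>\<A> \<subseteq> S" "\<And>X. X \<in> M \<Longrightarrow> \<Union>\<A> \<subseteq> X \<Longrightarrow> S \<subseteq> X"
  shows "\<Squnion>\<^bsub>inclusion_order M\<^esub> \<A> = S"
  using assms
  by (intro partial_order.sup_eqI[OF inclusion_partial_order]) (auto simp: is_lub_iff Sup_le_iff)

lemma inclusion_top:
  "\<lbrakk>U \<in> M; \<And>X. X \<in> M \<Longrightarrow> X \<subseteq> U\<rbrakk> \<Longrightarrow> \<top>\<^bsub>inclusion_order M\<^esub> = U"
  by (rule partial_order.top_eqI[OF inclusion_partial_order]) auto

text \<open>
  Intersection with \<open>X\<close> has a right adjoint, hence preserves joins: if every \<open>X \<inter> A\<close> is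
  contained in \<open>Z\<close>, then every \<open>A\<close> is contained in the residual of \<open>Z\<close> by \<open>X\<close>, and therefore so is
  their join.
\<close>

lemma residuated_closure_system_frame:
  assumes top: "U \<in> M" "\<And>X. X \<in> M \<Longrightarrow> X \<subseteq> U"
    and Inter: "\<And>\<A>. \<lbrakk>\<A> \<subseteq> M; \<A> \<noteq> {}\<rbrakk> \<Longrightarrow> \<Inter>\<A> \<in> M"
    and residual: "\<And>X Z. \<lbrakk>X \<in> M; Z \<in> M\<rbrakk> \<Longrightarrow> \<exists>Y\<in>M. \<forall>W\<in>M. X \<inter> W \<subseteq> Z \<longleftrightarrow> W \<subseteq> Y"
  shows "frame (inclusion_order M)"
proof (rule kappa_frameI)
  let ?L = "inclusion_order M"
  have Int: "X \<inter> Y \<in> M" if "X \<in> M" "Y \<in> M" for X Y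
    using Inter[of "{X, Y}"] that by simp
  show "\<exists>m. is_glb ?L m {X, Y}" if "X \<in> carrier ?L" "Y \<in> carrier ?L" for X Y
    using that Int by (intro exI[of _ "X \<inter> Y"]) (auto simp: is_glb_iff)
  show "\<exists>s. is_lub ?L s \<A>" if "\<A> \<subseteq> carrier ?L" for \<A>
  proof
    have "\<Inter>{X \<in> M. \<Union>\<A> \<subseteq> X} \<in> M"
      using that top by (intro Inter) auto
    then show "is_lub ?L (\<Inter>{X \<in> M. \<Union>\<A> \<subseteq> X}) \<A>"
      using that by (auto simp: is_lub_iff Sup_le_iff)
  qed
  show "X \<sqinter>\<^bsub>?L\<^esub> S \<sqsubseteq>\<^bsub>?L\<^esub> Z"
    if X: "X \<in> carrier ?L" and \<A>: "\<A> \<subseteq> carrier ?L" and S: "is_lub ?L S \<A>"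
      and Z: "Z \<in> carrier ?L" and le: "\<And>A. A \<in> \<A> \<Longrightarrow> X \<sqinter>\<^bsub>?L\<^esub> A \<sqsubseteq>\<^bsub>?L\<^esub> Z"
    for X \<A> S Z
  proof -
    obtain Y where Y: "Y \<in> M" "\<And>W. W \<in> M \<Longrightarrow> X \<inter> W \<subseteq> Z \<longleftrightarrow> W \<subseteq> Y"
      using residual X Z by force
    have "A \<subseteq> Y" if "A \<in> \<A>" for A
    proof -
      have "A \<in> M" using that \<A> by auto
      then show ?thesis using le[OF that] X Y(2)[of A] Int by (simp add: inclusion_meet)
    qed
    then have SM: "S \<in> M" and "S \<subseteq> Y"
      using S \<A> Y(1) by (simp_all add: is_lub_iff)
    then have "X \<inter> S \<subseteq> Z" using Y(2) by blast
    then show ?thesis using X SM Int by (simp add: inclusion_meet)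
  qed
qed (use top inclusion_partial_order in auto)

section \<open>The frame of \<kappa>-ideals\<close>

lemma kappa_ideal_subset: "kappa_ideal \<kappa> L I \<Longrightarrow> I \<subseteq> carrier L"
  by (simp add: kappa_ideal_def)

lemma kappa_ideal_down:
  "\<lbrakk>kappa_ideal \<kappa> L I; x \<in> I; y \<in> carrier L; y \<sqsubseteq>\<^bsub>L\<^esub> x\<rbrakk> \<Longrightarrow> y \<in> I"
  by (simp add: kappa_ideal_def)

lemma kappa_ideal_sup:
  "\<lbrakk>kappa_ideal \<kappa> L I; T \<subseteq> I; kappa_set \<kappa> T\<rbrakk> \<Longrightarrow> \<Squnion>\<^bsub>L\<^esub> T \<in> I"
  by (simp add: kappa_ideal_def)

lemma carrier_ideal_frame: "carrier (ideal_frame \<kappa> L) = {I. kappa_ideal \<kappa> L I}"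
  by (simp add: ideal_frame_def)

lemma le_ideal_frame: "I \<sqsubseteq>\<^bsub>ideal_frame \<kappa> L\<^esub> J \<longleftrightarrow> I \<subseteq> J"
  by (simp add: ideal_frame_def)

context regular_kappa_frame
begin

lemma kappa_ideal_meet:
  "\<lbrakk>kappa_ideal \<kappa> L I; x \<in> I; y \<in> carrier L\<rbrakk> \<Longrightarrow> x \<sqinter> y \<in> I \<and> y \<sqinter> x \<in> I"
  using kappa_ideal_down[of \<kappa> L I x] kappa_ideal_subset[of \<kappa> L I]
  by (auto simp: meet_left meet_right subset_iff)

lemma kappa_ideal_join:
  "\<lbrakk>kappa_ideal \<kappa> L I; x \<in> I; y \<in> I\<rbrakk> \<Longrightarrow> x \<squnion> y \<in> I"
  by (simp add: join_def kappa_ideal_sup)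

lemma kappa_ideal_carrier: "kappa_ideal \<kappa> L (carrier L)"
  by (simp add: kappa_ideal_def)

lemma kappa_ideal_Inter:
  assumes "\<And>I. I \<in> \<I> \<Longrightarrow> kappa_ideal \<kappa> L I" "\<I> \<noteq> {}"
  shows "kappa_ideal \<kappa> L (\<Inter>\<I>)"
  using assms unfolding kappa_ideal_def by blast

lemma kappa_ideal_Int:
  "\<lbrakk>kappa_ideal \<kappa> L I; kappa_ideal \<kappa> L J\<rbrakk> \<Longrightarrow> kappa_ideal \<kappa> L (I \<inter> J)"
  using kappa_ideal_Inter[of "{I, J}"] by auto

text \<open>
  The Heyting implication of ideals. Its closure under \<open>\<kappa>\<close>-joins is the distributive law of \<open>L\<close>.
\<close>

lemma kappa_ideal_residual:
  assumes I: "kappa_ideal \<kappa> L I" and J: "kappa_ideal \<kappa> L J"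
  shows "kappa_ideal \<kappa> L {a \<in> carrier L. \<forall>x\<in>I. x \<sqinter> a \<in> J}" (is "kappa_ideal \<kappa> L ?R")
  unfolding kappa_ideal_def
proof (intro conjI ballI allI impI)
  show "b \<in> ?R" if "a \<in> ?R" "b \<in> carrier L" "b \<sqsubseteq> a" for a b
  proof -
    have "x \<sqinter> b \<in> J" if "x \<in> I" for x
    proof (rule kappa_ideal_down[OF J])
      show "x \<sqinter> a \<in> J" using \<open>a \<in> ?R\<close> that by blast
      have x: "x \<in> carrier L" using kappa_ideal_subset[OF I] that by blast
      show "x \<sqinter> b \<in> carrier L" using x \<open>b \<in> carrier L\<close> by simp
      show "x \<sqinter> b \<sqsubseteq> x \<sqinter> a"
        using x \<open>a \<in> ?R\<close> \<open>b \<in> carrier L\<close> \<open>b \<sqsubseteq> a\<close>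
        by (metis (no_types, lifting) CollectD le_trans meet_closed meet_le meet_left meet_right)
    qed
    then show ?thesis using that by blast
  qed
  show "\<Squnion>T \<in> ?R" if T: "T \<subseteq> ?R" "kappa_set \<kappa> T" for T
  proof -
    have "x \<sqinter> \<Squnion>T \<in> J" if "x \<in> I" for x
    proof -
      have "x \<in> carrier L" "T \<subseteq> carrier L" using that T kappa_ideal_subset[OF I] by auto
      then have "x \<sqinter> \<Squnion>T = \<Squnion>((\<lambda>a. x \<sqinter> a) ` T)" using T by (simp add: meet_kappa_sup_distrib)
      also have "\<dots> \<in> J"
        using T that by (intro kappa_ideal_sup[OF J] kappa_set_image) auto
      finally show ?thesis .
    qed
    moreover have "\<Squnion>T \<in> carrier L" using T by (intro sup_closed) auto
    ultimately show ?thesis by simp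
  qed
qed auto

lemma ideal_frame_frame: "frame (ideal_frame \<kappa> L)"
  unfolding ideal_frame_def
proof (rule residuated_closure_system_frame)
  show "carrier L \<in> {I. kappa_ideal \<kappa> L I}" by (simp add: kappa_ideal_carrier)
  show "\<exists>Y\<in>{I. kappa_ideal \<kappa> L I}. \<forall>W\<in>{I. kappa_ideal \<kappa> L I}. I \<inter> W \<subseteq> J \<longleftrightarrow> W \<subseteq> Y"
    if "I \<in> {I. kappa_ideal \<kappa> L I}" "J \<in> {I. kappa_ideal \<kappa> L I}" for I J
  proof (intro bexI ballI iffI)
    fix W assume W: "W \<in> {I. kappa_ideal \<kappa> L I}"
    show "W \<subseteq> {a \<in> carrier L. \<forall>x\<in>I. x \<sqinter> a \<in> J}" if IW: "I \<inter> W \<subseteq> J"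
    proof
      fix w assume w: "w \<in> W"
      then have wc: "w \<in> carrier L" using W kappa_ideal_subset by blast
      have "x \<sqinter> w \<in> I \<inter> W" if x: "x \<in> I" for x
      proof -
        have "x \<in> carrier L" using x \<open>I \<in> _\<close> kappa_ideal_subset by blast
        then show ?thesis
          using kappa_ideal_meet[of I x w] kappa_ideal_meet[of W w x] x w wc W \<open>I \<in> _\<close> by simp
      qed
      then show "w \<in> {a \<in> carrier L. \<forall>x\<in>I. x \<sqinter> a \<in> J}" using IW wc by blast
    qed
    show "I \<inter> W \<subseteq> J" if "W \<subseteq> {a \<in> carrier L. \<forall>x\<in>I. x \<sqinter> a \<in> J}"
      using that by (force simp: meet_idem)
  next
    show "{a \<in> carrier L. \<forall>x\<in>I. x \<sqinter> a \<in> J} \<in> {I. kappa_ideal \<kappa> L I}"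
      using kappa_ideal_residual that by simp
  qed
qed (auto intro: kappa_ideal_Inter dest: kappa_ideal_subset)

lemma ideal_frame_meet:
  "\<lbrakk>kappa_ideal \<kappa> L I; kappa_ideal \<kappa> L J\<rbrakk> \<Longrightarrow> I \<sqinter>\<^bsub>ideal_frame \<kappa> L\<^esub> J = I \<inter> J"
  unfolding ideal_frame_def by (rule inclusion_meet) (auto intro: kappa_ideal_Int)

lemma ideal_frame_top: "\<top>\<^bsub>ideal_frame \<kappa> L\<^esub> = carrier L"
  unfolding ideal_frame_def
  by (rule inclusion_top) (auto dest: kappa_ideal_subset intro: kappa_ideal_carrier)

text \<open>
  Regularity of \<open>\<kappa>\<close> enters here: a \<open>\<kappa>\<close>-join of elements that lie below \<open>\<kappa>\<close>-joins of elements of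
  \<open>S\<close> lies below the join of the union of the sets involved, and this union is again a \<open>\<kappa>\<close>-set.
\<close>

lemma kappa_ideal_generated:
  assumes S: "S \<subseteq> carrier L"
  shows "kappa_ideal \<kappa> L {x \<in> carrier L. \<exists>T\<subseteq>S. kappa_set \<kappa> T \<and> x \<sqsubseteq> \<Squnion>T}" (is "kappa_ideal \<kappa> L ?G")
  unfolding kappa_ideal_def
proof (intro conjI ballI allI impI)
  show "y \<in> ?G" if x: "x \<in> ?G" and y: "y \<in> carrier L" "y \<sqsubseteq> x" for x y
  proof -
    obtain T where xc: "x \<in> carrier L" and T: "T \<subseteq> S" "kappa_set \<kappa> T" "x \<sqsubseteq> \<Squnion>T"
      using x by blast
    have "\<Squnion>T \<in> carrier L" using T S by (intro sup_closed) auto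
    then have "y \<sqsubseteq> \<Squnion>T" using le_trans[OF y(2) T(3)] y(1) xc by simp
    then show ?thesis using T(1,2) y(1) by (intro CollectI conjI exI[of _ T])
  qed
  show "\<Squnion>X \<in> ?G" if X: "X \<subseteq> ?G" "kappa_set \<kappa> X" for X
  proof -
    have "\<forall>x\<in>X. \<exists>T\<subseteq>S. kappa_set \<kappa> T \<and> x \<sqsubseteq> \<Squnion>T" using X(1) by (simp add: subset_iff)
    then obtain T where T: "\<And>x. x \<in> X \<Longrightarrow> T x \<subseteq> S \<and> kappa_set \<kappa> (T x) \<and> x \<sqsubseteq> \<Squnion>(T x)"
      by metis
    define T' where "T' = (\<Union>x\<in>X. T x)"
    have T'S: "T' \<subseteq> S" using T by (auto simp: T'_def)
    have T'k: "kappa_set \<kappa> T'" unfolding T'_def using T by (intro kappa_set_UN regular X) auto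
    have T'c: "T' \<subseteq> carrier L" using T'S S by blast
    have Xc: "X \<subseteq> carrier L" using X by blast
    have "\<Squnion>X \<sqsubseteq> \<Squnion>T'"
    proof (rule sup_least[OF Xc X(2)])
      show "\<Squnion>T' \<in> carrier L" using T'c T'k by simp
      show "x \<sqsubseteq> \<Squnion>T'" if "x \<in> X" for x
      proof (rule le_trans)
        show "x \<sqsubseteq> \<Squnion>(T x)" using T that by blast
        show "\<Squnion>(T x) \<sqsubseteq> \<Squnion>T'" using that T'c T'k by (intro sup_mono) (auto simp: T'_def)
        show "\<Squnion>(T x) \<in> carrier L" using T[OF that] S by (intro sup_closed) auto
      qed (use that Xc T'c T'k in auto)
    qed
    moreover have "\<Squnion>X \<in> carrier L" using Xc X(2) by simp
    ultimately show ?thesis using T'S T'k by (intro CollectI conjI exI[of _ T'])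
  qed
qed auto

lemma ideal_frame_sup:
  assumes "\<I> \<subseteq> {I. kappa_ideal \<kappa> L I}"
  shows "\<Squnion>\<^bsub>ideal_frame \<kappa> L\<^esub> \<I> = {x \<in> carrier L. \<exists>T\<subseteq>\<Union>\<I>. kappa_set \<kappa> T \<and> x \<sqsubseteq> \<Squnion>T}"
    (is "_ = ?G")
  unfolding ideal_frame_def
proof (rule inclusion_sup)
  have c: "\<Union>\<I> \<subseteq> carrier L" using assms kappa_ideal_subset by blast
  then show "?G \<in> {I. kappa_ideal \<kappa> L I}" using kappa_ideal_generated by simp
  show "\<Union>\<I> \<subseteq> ?G"
  proof
    fix x assume x: "x \<in> \<Union>\<I>"
    then have "{x} \<subseteq> \<Union>\<I> \<and> kappa_set \<kappa> {x} \<and> x \<sqsubseteq> \<Squnion>{x}" using c by auto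
    then show "x \<in> ?G" using x c by blast
  qed
  show "?G \<subseteq> J" if "J \<in> {I. kappa_ideal \<kappa> L I}" "\<Union>\<I> \<subseteq> J" for J
  proof
    fix x assume "x \<in> ?G"
    then obtain T where T: "x \<in> carrier L" "T \<subseteq> \<Union>\<I>" "kappa_set \<kappa> T" "x \<sqsubseteq> \<Squnion>T" by blast
    then have "\<Squnion>T \<in> J" using that by (intro kappa_ideal_sup) auto
    then show "x \<in> J" using kappa_ideal_down[of \<kappa> L J "\<Squnion>T" x] T that(1) by simp
  qed
qed (use assms in auto)

end


section \<open>The frame of \<kappa>-congruences\<close>

lemma kappa_congruence_carrier:
  "\<lbrakk>kappa_congruence \<kappa> L C; (a, b) \<in> C\<rbrakk> \<Longrightarrow> a \<in> carrier L \<and> b \<in> carrier L"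
  unfolding kappa_congruence_def by (auto dest: equiv_type)

lemma kappa_congruence_refl:
  "\<lbrakk>kappa_congruence \<kappa> L C; a \<in> carrier L\<rbrakk> \<Longrightarrow> (a, a) \<in> C"
  unfolding kappa_congruence_def by (auto simp: equiv_def refl_on_def)

lemma kappa_congruence_sym:
  "\<lbrakk>kappa_congruence \<kappa> L C; (a, b) \<in> C\<rbrakk> \<Longrightarrow> (b, a) \<in> C"
  unfolding kappa_congruence_def by (auto simp: equiv_def dest: symD)

lemma kappa_congruence_trans:
  "\<lbrakk>kappa_congruence \<kappa> L C; (a, b) \<in> C; (b, c) \<in> C\<rbrakk> \<Longrightarrow> (a, c) \<in> C"
  unfolding kappa_congruence_def by (auto simp: equiv_def dest: transD)

lemma kappa_congruence_meet:
  "\<lbrakk>kappa_congruence \<kappa> L C; (a, b) \<in> C; (c, d) \<in> C\<rbrakk> \<Longrightarrow> (a \<sqinter>\<^bsub>L\<^esub> c, b \<sqinter>\<^bsub>L\<^esub> d) \<in> C"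
  unfolding kappa_congruence_def by simp

lemma kappa_congruence_sup:
  "\<lbrakk>kappa_congruence \<kappa> L C; S \<subseteq> C; kappa_set \<kappa> S\<rbrakk>
    \<Longrightarrow> (\<Squnion>\<^bsub>L\<^esub> (fst ` S), \<Squnion>\<^bsub>L\<^esub> (snd ` S)) \<in> C"
  unfolding kappa_congruence_def by simp

lemma kappa_congruence_sup_image:
  assumes "kappa_congruence \<kappa> L C" "kappa_set \<kappa> T" "\<And>t. t \<in> T \<Longrightarrow> (f t, g t) \<in> C"
  shows "(\<Squnion>\<^bsub>L\<^esub> (f ` T), \<Squnion>\<^bsub>L\<^esub> (g ` T)) \<in> C"
  using kappa_congruence_sup[OF assms(1), of "(\<lambda>t. (f t, g t)) ` T"] assms(2,3)
  by (simp add: kappa_set_image image_image image_subset_iff)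

context regular_kappa_frame
begin

lemma kappa_congruence_join:
  assumes "kappa_congruence \<kappa> L C" "(a, b) \<in> C" "(c, d) \<in> C"
  shows "(a \<squnion> c, b \<squnion> d) \<in> C"
  using kappa_congruence_sup[OF assms(1), of "{(a, b), (c, d)}"] assms(2,3)
  by (simp add: join_def)

lemma kappa_congruenceI:
  assumes "\<And>a b. (a, b) \<in> C \<Longrightarrow> a \<in> carrier L \<and> b \<in> carrier L"
    and "\<And>a. a \<in> carrier L \<Longrightarrow> (a, a) \<in> C"
    and "\<And>a b. (a, b) \<in> C \<Longrightarrow> (b, a) \<in> C"
    and "\<And>a b c. (a, b) \<in> C \<Longrightarrow> (b, c) \<in> C \<Longrightarrow> (a, c) \<in> C"
    and "\<And>a b c d. (a, b) \<in> C \<Longrightarrow> (c, d) \<in> C \<Longrightarrow> (a \<sqinter> c, b \<sqinter> d) \<in> C"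
    and "\<And>S. S \<subseteq> C \<Longrightarrow> kappa_set \<kappa> S \<Longrightarrow> (\<Squnion>(fst ` S), \<Squnion>(snd ` S)) \<in> C"
  shows "kappa_congruence \<kappa> L C"
  unfolding kappa_congruence_def
proof (intro conjI allI impI)
  show "equiv (carrier L) C"
  proof (rule equivI)
    show "C \<subseteq> carrier L \<times> carrier L" using assms(1) by (simp add: subset_iff)
    show "refl_on (carrier L) C" using assms(1,2) by (simp add: refl_on_def)
    show "sym C" using assms(3) unfolding sym_def by blast
    show "trans C" using assms(4) unfolding trans_def by blast
  qed
qed (simp_all add: assms(2,5,6))

lemma kappa_congruence_total: "kappa_congruence \<kappa> L (carrier L \<times> carrier L)"
  by (rule kappa_congruenceI) (auto intro!: sup_closed kappa_set_image)

lemma kappa_congruence_Inter: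
  assumes "\<And>C. C \<in> \<C> \<Longrightarrow> kappa_congruence \<kappa> L C" "\<C> \<noteq> {}"
  shows "kappa_congruence \<kappa> L (\<Inter>\<C>)"
proof (rule kappa_congruenceI)
  show "(\<Squnion>(fst ` S), \<Squnion>(snd ` S)) \<in> \<Inter>\<C>" if "S \<subseteq> \<Inter>\<C>" "kappa_set \<kappa> S" for S
    using kappa_congruence_sup[OF assms(1)] that by (simp add: le_Inf_iff)
  show "a \<in> carrier L \<and> b \<in> carrier L" if "(a, b) \<in> \<Inter>\<C>" for a b
    using that assms kappa_congruence_carrier by fast
  show "(a, a) \<in> \<Inter>\<C>" if "a \<in> carrier L" for a
    using that assms(1) kappa_congruence_refl by fast
  show "(b, a) \<in> \<Inter>\<C>" if "(a, b) \<in> \<Inter>\<C>" for a b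
    using that assms(1) kappa_congruence_sym by fast
  show "(a, c) \<in> \<Inter>\<C>" if "(a, b) \<in> \<Inter>\<C>" "(b, c) \<in> \<Inter>\<C>" for a b c
    by (rule InterI) (rule kappa_congruence_trans[OF assms(1)], use that in auto)
  show "(a \<sqinter> c, b \<sqinter> d) \<in> \<Inter>\<C>" if "(a, b) \<in> \<Inter>\<C>" "(c, d) \<in> \<Inter>\<C>" for a b c d
    by (rule InterI) (rule kappa_congruence_meet[OF assms(1)], use that in auto)
qed

lemma kappa_congruence_Int:
  "\<lbrakk>kappa_congruence \<kappa> L C; kappa_congruence \<kappa> L D\<rbrakk> \<Longrightarrow> kappa_congruence \<kappa> L (C \<inter> D)"
  using kappa_congruence_Inter[of "{C, D}"] by auto

text \<open>
  For fixed \<open>x\<close> and \<open>y\<close> this is the retraction of \<open>L\<close> onto the interval from \<open>x\<close> to \<open>x \<squnion> y\<close>. By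
  distributivity it preserves binary meets and nonempty \<open>\<kappa>\<close>-joins, and it respects every congruence, being
  a lattice polynomial.
\<close>

definition project :: "'a \<Rightarrow> 'a \<Rightarrow> 'a \<Rightarrow> 'a" where
  "project x y a = x \<squnion> (y \<sqinter> a)"

lemma project_closed [simp]:
  "\<lbrakk>x \<in> carrier L; y \<in> carrier L; a \<in> carrier L\<rbrakk> \<Longrightarrow> project x y a \<in> carrier L"
  by (simp add: project_def)

lemma project_meet:
  assumes "x \<in> carrier L" "y \<in> carrier L" "a \<in> carrier L" "b \<in> carrier L"
  shows "project x y (a \<sqinter> b) = project x y a \<sqinter> project x y b"
proof -
  have "y \<sqinter> (a \<sqinter> b) = (y \<sqinter> a) \<sqinter> (y \<sqinter> b)"
    using assms by (metis meet_assoc meet_closed meet_comm meet_idem)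
  then show ?thesis using assms by (simp add: project_def join_meet_distrib)
qed

text \<open>
  The additional member \<open>x\<close>, which lies below all the others, makes the formula correct for empty \<open>T\<close>.
\<close>

lemma project_sup:
  assumes x: "x \<in> carrier L" and y: "y \<in> carrier L" and T: "T \<subseteq> carrier L" "kappa_set \<kappa> T"
  shows "project x y (\<Squnion>T) = \<Squnion>(insert x (project x y ` T))"
proof -
  let ?P = "insert x (project x y ` T)"
  have P: "?P \<subseteq> carrier L" using assms by auto
  have k: "kappa_set \<kappa> ?P" using T by (intro kappa_set_insert kappa_set_image regular)
  have sT: "\<Squnion>T \<in> carrier L" using T by simp
  have sP: "\<Squnion>?P \<in> carrier L" using P k by simp
  have "project x y (\<Squnion>T) \<sqsubseteq> \<Squnion>?P"
    unfolding project_def[of x y "\<Squnion>T"]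
  proof (rule join_le)
    show "x \<sqsubseteq> \<Squnion>?P" using P k by (intro sup_upper) auto
    show "y \<sqinter> \<Squnion>T \<sqsubseteq> \<Squnion>?P"
    proof (rule meet_sup_upper[OF y T sP])
      fix a assume a: "a \<in> T"
      then have ac: "a \<in> carrier L" using T by auto
      have "y \<sqinter> a \<sqsubseteq> project x y a"
        unfolding project_def using x y ac by (intro join_right) simp_all
      moreover have "project x y a \<sqsubseteq> \<Squnion>?P" using P k a by (intro sup_upper) simp_all
      ultimately show "y \<sqinter> a \<sqsubseteq> \<Squnion>?P" by (rule le_trans) (use x y ac sP in simp_all)
    qed
  qed (use x y sT sP in simp_all)
  moreover have "\<Squnion>?P \<sqsubseteq> project x y (\<Squnion>T)"
  proof (rule sup_least[OF P k])
    fix p assume "p \<in> ?P"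
    then consider "p = x" | a where "a \<in> T" "p = project x y a" by blast
    then show "p \<sqsubseteq> project x y (\<Squnion>T)"
    proof cases
      case 1
      then show ?thesis unfolding project_def using x y sT by (simp add: join_left)
    next
      case 2
      then have a: "a \<in> carrier L" "a \<sqsubseteq> \<Squnion>T" using T by (auto intro: sup_upper)
      then have "project x y a = project x y a \<sqinter> project x y (\<Squnion>T)"
        using project_meet[OF x y a(1) sT] sT by (simp add: meet_absorb1)
      then show ?thesis
        using 2 x y a sT by (simp add: le_iff_join)
    qed
  qed (use x y sT in simp)
  ultimately show ?thesis
    using x y sT sP by (simp add: le_antisym)
qed

text \<open>
  The Heyting implication of congruences: the largest relation that every projection to an interval
  collapsed by \<open>C\<close> maps into \<open>E\<close>. As an intersection of inverse images of \<open>E\<close> under maps that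
  preserve binary meets and nonempty \<open>\<kappa>\<close>-joins, it is again a congruence.
\<close>

definition congruence_residual :: "'a rel \<Rightarrow> 'a rel \<Rightarrow> 'a rel" where
  "congruence_residual C E =
    {(a, b). a \<in> carrier L \<and> b \<in> carrier L \<and> (\<forall>(x, y)\<in>C. (project x y a, project x y b) \<in> E)}"

lemma kappa_congruence_residual:
  assumes C: "kappa_congruence \<kappa> L C" and E: "kappa_congruence \<kappa> L E"
  shows "kappa_congruence \<kappa> L (congruence_residual C E)" (is "kappa_congruence \<kappa> L ?R")
proof (rule kappa_congruenceI)
  note Cc = kappa_congruence_carrier[OF C]
  have RE: "(project x y a, project x y b) \<in> E" if "(a, b) \<in> ?R" "(x, y) \<in> C" for a b x y
    using that unfolding congruence_residual_def by auto
  have RI: "(a, b) \<in> ?R" if "a \<in> carrier L" "b \<in> carrier L"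
    "\<And>x y. (x, y) \<in> C \<Longrightarrow> x \<in> carrier L \<Longrightarrow> y \<in> carrier L \<Longrightarrow> (project x y a, project x y b) \<in> E" for a b
    using that Cc unfolding congruence_residual_def by auto
  show Rc: "a \<in> carrier L \<and> b \<in> carrier L" if "(a, b) \<in> ?R" for a b
    using that unfolding congruence_residual_def by simp
  show "(a, a) \<in> ?R" if "a \<in> carrier L" for a
    by (rule RI) (use that in \<open>simp_all add: kappa_congruence_refl[OF E]\<close>)
  show "(b, a) \<in> ?R" if "(a, b) \<in> ?R" for a b
    by (rule RI) (use Rc[OF that] RE[OF that] in \<open>simp_all add: kappa_congruence_sym[OF E]\<close>)
  show "(a, c) \<in> ?R" if "(a, b) \<in> ?R" "(b, c) \<in> ?R" for a b c
  proof (rule RI)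
    show "(project x y a, project x y c) \<in> E" if "(x, y) \<in> C" for x y
      by (rule kappa_congruence_trans[OF E RE RE]) (fact that \<open>(a, b) \<in> ?R\<close> \<open>(b, c) \<in> ?R\<close>)+
  qed (use that Rc in simp_all)
  show "(a \<sqinter> c, b \<sqinter> d) \<in> ?R" if ab: "(a, b) \<in> ?R" and cd: "(c, d) \<in> ?R" for a b c d
  proof (rule RI)
    show "(project x y (a \<sqinter> c), project x y (b \<sqinter> d)) \<in> E"
      if "(x, y) \<in> C" "x \<in> carrier L" "y \<in> carrier L" for x y
      using kappa_congruence_meet[OF E RE[OF ab] RE[OF cd]] that Rc[OF ab] Rc[OF cd]
      by (simp add: project_meet)
  qed (use Rc[OF ab] Rc[OF cd] in simp_all)
  show "(\<Squnion>(fst ` S), \<Squnion>(snd ` S)) \<in> ?R" if S: "S \<subseteq> ?R" "kappa_set \<kappa> S" for S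
  proof (rule RI)
    have c: "fst ` S \<subseteq> carrier L" "snd ` S \<subseteq> carrier L" using S(1) Rc by auto
    have k: "kappa_set \<kappa> (fst ` S)" "kappa_set \<kappa> (snd ` S)" using S(2) by (simp_all add: kappa_set_image)
    show "\<Squnion>(fst ` S) \<in> carrier L" "\<Squnion>(snd ` S) \<in> carrier L" using c k by simp_all
    fix x y assume xy: "(x, y) \<in> C" "x \<in> carrier L" "y \<in> carrier L"
    let ?P = "insert (x, x) ((\<lambda>p. (project x y (fst p), project x y (snd p))) ` S)"
    have "?P \<subseteq> E"
      using S(1) RE[OF _ xy(1)] kappa_congruence_refl[OF E xy(2)] by force
    moreover have "kappa_set \<kappa> ?P" using S(2) by (intro kappa_set_insert kappa_set_image regular)
    ultimately have "(\<Squnion>(fst ` ?P), \<Squnion>(snd ` ?P)) \<in> E" by (rule kappa_congruence_sup[OF E])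
    moreover have "fst ` ?P = insert x (project x y ` fst ` S)"
      "snd ` ?P = insert x (project x y ` snd ` S)"
      by (simp_all add: image_image)
    ultimately show "(project x y (\<Squnion>(fst ` S)), project x y (\<Squnion>(snd ` S))) \<in> E"
      using xy c k by (simp add: project_sup)
  qed
qed

text \<open>
  Projecting a pair of \<open>D\<close> to the interval of a pair of \<open>C\<close> gives a pair in \<open>D\<close>, and also in \<open>C\<close> as
  \<open>C\<close> collapses the interval. Conversely, a pair \<open>(a, b)\<close> in both relations is recovered from its own
  projection to the interval from \<open>a \<sqinter> b\<close> to \<open>a \<squnion> b\<close>, which \<open>C\<close> collapses.
\<close>

lemma congruence_residual_iff:
  assumes C: "kappa_congruence \<kappa> L C" and D: "kappa_congruence \<kappa> L D"
    and E: "kappa_congruence \<kappa> L E"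
  shows "C \<inter> D \<subseteq> E \<longleftrightarrow> D \<subseteq> congruence_residual C E"
proof
  assume CDE: "C \<inter> D \<subseteq> E"
  show "D \<subseteq> congruence_residual C E"
  proof
    fix p assume "p \<in> D"
    then obtain a b where p: "p = (a, b)" and ab: "(a, b) \<in> D" by (cases p) auto
    have c: "a \<in> carrier L" "b \<in> carrier L" using kappa_congruence_carrier[OF D ab] by auto
    have "(project x y a, project x y b) \<in> E" if xy: "(x, y) \<in> C" for x y
    proof -
      have xc: "x \<in> carrier L" "y \<in> carrier L" using kappa_congruence_carrier[OF C xy] by auto
      have "(project x y a, project x y b) \<in> D"
        unfolding project_def
        using kappa_congruence_join[OF D kappa_congruence_refl[OF D xc(1)]
            kappa_congruence_meet[OF D kappa_congruence_refl[OF D xc(2)] ab]] .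
      moreover have pC: "(project x y u, x) \<in> C" if "u \<in> carrier L" for u
        using kappa_congruence_join[OF C kappa_congruence_refl[OF C xc(1)]
            kappa_congruence_meet[OF C kappa_congruence_sym[OF C xy] kappa_congruence_refl[OF C that]]]
          xc that by (simp add: project_def join_meet_absorb)
      have "(project x y a, project x y b) \<in> C"
        by (rule kappa_congruence_trans[OF C pC[OF c(1)] kappa_congruence_sym[OF C pC[OF c(2)]]])
      ultimately show ?thesis using CDE by blast
    qed
    then show "p \<in> congruence_residual C E"
      using c by (auto simp: congruence_residual_def p)
  qed
next
  assume DR: "D \<subseteq> congruence_residual C E"
  show "C \<inter> D \<subseteq> E"
  proof
    fix p assume "p \<in> C \<inter> D"
    then obtain a b where p: "p = (a, b)" and ab: "(a, b) \<in> C" "(a, b) \<in> D" by (cases p) auto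
    have c: "a \<in> carrier L" "b \<in> carrier L" using kappa_congruence_carrier[OF D ab(2)] by auto
    have aC: "(a \<sqinter> b, a) \<in> C" "(a, a \<squnion> b) \<in> C"
      using kappa_congruence_meet[OF C kappa_congruence_refl[OF C c(1)] kappa_congruence_sym[OF C ab(1)]]
        kappa_congruence_join[OF C kappa_congruence_refl[OF C c(1)] ab(1)] c
      by (simp_all add: meet_idem) (simp add: join_def)
    then have "(a \<sqinter> b, a \<squnion> b) \<in> C" by (rule kappa_congruence_trans[OF C])
    moreover have "(a, b) \<in> congruence_residual C E" using DR ab(2) by blast
    ultimately have "(project (a \<sqinter> b) (a \<squnion> b) a, project (a \<sqinter> b) (a \<squnion> b) b) \<in> E"
      unfolding congruence_residual_def by auto
    moreover have "project (a \<sqinter> b) (a \<squnion> b) a = a" "project (a \<sqinter> b) (a \<squnion> b) b = b"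
      unfolding project_def using c
      by (metis join_comm meet_comm meet_join_absorb join_meet_absorb)+
    ultimately show "p \<in> E" by (simp add: p)
  qed
qed

lemma congruence_frame_frame: "frame (congruence_frame \<kappa> L)"
  unfolding congruence_frame_def
proof (rule residuated_closure_system_frame)
  show "carrier L \<times> carrier L \<in> {C. kappa_congruence \<kappa> L C}"
    by (simp add: kappa_congruence_total)
  show "C \<subseteq> carrier L \<times> carrier L" if "C \<in> {C. kappa_congruence \<kappa> L C}" for C
    using that kappa_congruence_carrier by fast
  show "\<Inter>\<C> \<in> {C. kappa_congruence \<kappa> L C}" if "\<C> \<subseteq> {C. kappa_congruence \<kappa> L C}" "\<C> \<noteq> {}" for \<C>
    using that kappa_congruence_Inter[of \<C>] by blast
  show "\<exists>R\<in>{C. kappa_congruence \<kappa> L C}. \<forall>D\<in>{C. kappa_congruence \<kappa> L C}. C \<inter> D \<subseteq> E \<longleftrightarrow> D \<subseteq> R"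
    if "C \<in> {C. kappa_congruence \<kappa> L C}" "E \<in> {C. kappa_congruence \<kappa> L C}" for C E
    using that kappa_congruence_residual congruence_residual_iff
    by (intro bexI[of _ "congruence_residual C E"]) simp_all
qed

lemma congruence_frame_top: "\<top>\<^bsub>congruence_frame \<kappa> L\<^esub> = carrier L \<times> carrier L"
  unfolding congruence_frame_def
  by (rule inclusion_top) (auto intro: kappa_congruence_total dest: kappa_congruence_carrier)

lemma congruence_frame_meet:
  "\<lbrakk>kappa_congruence \<kappa> L C; kappa_congruence \<kappa> L D\<rbrakk> \<Longrightarrow> C \<sqinter>\<^bsub>congruence_frame \<kappa> L\<^esub> D = C \<inter> D"
  unfolding congruence_frame_def by (rule inclusion_meet) (auto intro: kappa_congruence_Int)

lemma congruence_frame_sup: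
  assumes "\<And>C. C \<in> \<C> \<Longrightarrow> kappa_congruence \<kappa> L C"
  shows "\<Squnion>\<^bsub>congruence_frame \<kappa> L\<^esub> \<C> = \<Inter>{D. kappa_congruence \<kappa> L D \<and> \<Union>\<C> \<subseteq> D}"
  unfolding congruence_frame_def
proof (rule inclusion_sup)
  have "\<Union>\<C> \<subseteq> carrier L \<times> carrier L" using assms kappa_congruence_carrier by fast
  then show "\<Inter>{D. kappa_congruence \<kappa> L D \<and> \<Union>\<C> \<subseteq> D} \<in> {C. kappa_congruence \<kappa> L C}"
    using kappa_congruence_Inter[of "{D. kappa_congruence \<kappa> L D \<and> \<Union>\<C> \<subseteq> D}"] kappa_congruence_total
    by blast
qed (use assms in blast)+

end


section \<open>Quotients\<close>

locale kappa_frame_with_congruence = regular_kappa_frame \<kappa> L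
  for \<kappa> :: "'k rel option" and L (structure) +
  fixes C
  assumes congruence: "kappa_congruence \<kappa> L C"
begin

abbreviation Q where "Q \<equiv> quotient_lattice L C"

abbreviation q where "q \<equiv> quotient_map C"

lemmas cong_carrier = kappa_congruence_carrier[OF congruence]
  and cong_refl = kappa_congruence_refl[OF congruence]
  and cong_sym = kappa_congruence_sym[OF congruence]
  and cong_trans = kappa_congruence_trans[OF congruence]
  and cong_meet = kappa_congruence_meet[OF congruence]

lemma carrier_quotient: "carrier Q = q ` carrier L"
  by (auto simp: quotient_lattice_def quotient_def quotient_map_def)

lemma quotient_map_closed [simp]: "a \<in> carrier L \<Longrightarrow> q a \<in> carrier Q"
  by (simp add: carrier_quotient)

lemma mem_quotient_map: "x \<in> q a \<longleftrightarrow> (a, x) \<in> C"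
  by (simp add: quotient_map_def)

lemma quotient_map_eq_iff:
  assumes "b \<in> carrier L"
  shows "q a = q b \<longleftrightarrow> (a, b) \<in> C"
proof
  show "(a, b) \<in> C" if "q a = q b"
    using cong_refl[OF assms] that mem_quotient_map by blast
  show "q a = q b" if "(a, b) \<in> C"
    using that cong_sym cong_trans unfolding quotient_map_def by blast
qed

lemma quotient_le_iff:
  assumes a: "a \<in> carrier L" and b: "b \<in> carrier L"
  shows "q a \<sqsubseteq>\<^bsub>Q\<^esub> q b \<longleftrightarrow> (a \<sqinter> b, a) \<in> C"
proof
  show "(a \<sqinter> b, a) \<in> C" if "q a \<sqsubseteq>\<^bsub>Q\<^esub> q b"
    using that cong_refl[OF a] cong_refl[OF b] cong_sym
    by (auto simp: quotient_lattice_def mem_quotient_map)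
  show "q a \<sqsubseteq>\<^bsub>Q\<^esub> q b" if ab: "(a \<sqinter> b, a) \<in> C"
  proof -
    have "(a, x \<sqinter> y) \<in> C" if "(a, x) \<in> C" "(b, y) \<in> C" for x y
      using cong_trans[OF cong_sym[OF ab] cong_meet[OF that]] .
    then show ?thesis by (simp add: quotient_lattice_def mem_quotient_map)
  qed
qed

lemma quotient_map_mono:
  "\<lbrakk>a \<in> carrier L; b \<in> carrier L; a \<sqsubseteq> b\<rbrakk> \<Longrightarrow> q a \<sqsubseteq>\<^bsub>Q\<^esub> q b"
  by (simp add: quotient_le_iff meet_absorb1 cong_refl)

lemma quotient_partial_order: "partial_order Q"
proof
  show "x .=\<^bsub>Q\<^esub> x" for x by (simp add: quotient_lattice_def)
  show "y .=\<^bsub>Q\<^esub> x" if "x .=\<^bsub>Q\<^esub> y" for x y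
    using that by (simp add: quotient_lattice_def)
  show "x .=\<^bsub>Q\<^esub> z" if "x .=\<^bsub>Q\<^esub> y" "y .=\<^bsub>Q\<^esub> z" for x y z
    using that by (simp add: quotient_lattice_def)
  show "(.=\<^bsub>Q\<^esub>) = (=)" by (simp add: quotient_lattice_def)
  show "x \<sqsubseteq>\<^bsub>Q\<^esub> z \<longleftrightarrow> y \<sqsubseteq>\<^bsub>Q\<^esub> w" if "x .=\<^bsub>Q\<^esub> y" "z .=\<^bsub>Q\<^esub> w" for x y z w
    using that by (simp add: quotient_lattice_def)
  show "x \<sqsubseteq>\<^bsub>Q\<^esub> x" if "x \<in> carrier Q" for x
    using that by (auto simp: carrier_quotient quotient_map_mono)
  show "x .=\<^bsub>Q\<^esub> y" if xy: "x \<sqsubseteq>\<^bsub>Q\<^esub> y" "y \<sqsubseteq>\<^bsub>Q\<^esub> x" "x \<in> carrier Q" "y \<in> carrier Q" for x y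
  proof -
    obtain a b where ab: "a \<in> carrier L" "b \<in> carrier L" "x = q a" "y = q b"
      using xy(3,4) unfolding carrier_quotient by blast
    then have "(a \<sqinter> b, a) \<in> C" "(a \<sqinter> b, b) \<in> C"
      using xy(1,2) by (simp_all add: quotient_le_iff meet_comm)
    then have "(a, b) \<in> C" using cong_sym cong_trans by blast
    then show ?thesis using ab by (simp add: quotient_lattice_def quotient_map_eq_iff)
  qed
  show "x \<sqsubseteq>\<^bsub>Q\<^esub> z"
    if xyz: "x \<sqsubseteq>\<^bsub>Q\<^esub> y" "y \<sqsubseteq>\<^bsub>Q\<^esub> z" "x \<in> carrier Q" "y \<in> carrier Q" "z \<in> carrier Q" for x y z
  proof -
    obtain a b c where abc: "a \<in> carrier L" "b \<in> carrier L" "c \<in> carrier L"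
        "x = q a" "y = q b" "z = q c"
      using xyz(3-5) unfolding carrier_quotient by blast
    then have ab: "(a \<sqinter> b, a) \<in> C" and bc: "(b \<sqinter> c, b) \<in> C"
      using xyz(1,2) by (simp_all add: quotient_le_iff)
    have "(a \<sqinter> b \<sqinter> c, a \<sqinter> c) \<in> C" using cong_meet[OF ab cong_refl[OF abc(3)]] .
    moreover have "(a \<sqinter> b \<sqinter> c, a \<sqinter> b) \<in> C"
      using cong_meet[OF cong_refl[OF abc(1)] bc] abc by (simp add: meet_assoc)
    ultimately have "(a \<sqinter> c, a) \<in> C" using ab cong_sym cong_trans by blast
    then show ?thesis using abc by (simp add: quotient_le_iff)
  qed
qed

lemma quotient_is_glb:
  assumes a: "a \<in> carrier L" and b: "b \<in> carrier L"
  shows "is_glb Q (q (a \<sqinter> b)) {q a, q b}"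
proof -
  have "q c \<sqsubseteq>\<^bsub>Q\<^esub> q (a \<sqinter> b)"
    if c: "c \<in> carrier L" and le: "q c \<sqsubseteq>\<^bsub>Q\<^esub> q a" "q c \<sqsubseteq>\<^bsub>Q\<^esub> q b" for c
  proof -
    have ca: "(c \<sqinter> a, c) \<in> C" and cb: "(c \<sqinter> b, c) \<in> C"
      using le a b c by (simp_all add: quotient_le_iff)
    have "(c \<sqinter> a \<sqinter> b, c \<sqinter> b) \<in> C" using cong_meet[OF ca cong_refl[OF b]] .
    then have "(c \<sqinter> (a \<sqinter> b), c) \<in> C"
      using cong_trans cb a b c by (metis meet_assoc)
    then show ?thesis using a b c by (simp add: quotient_le_iff)
  qed
  then show ?thesis
    using a b by (auto simp: is_glb_iff carrier_quotient meet_left meet_right intro!: quotient_map_mono)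
qed

lemma quotient_is_lub:
  assumes T: "T \<subseteq> carrier L" "kappa_set \<kappa> T"
  shows "is_lub Q (q (\<Squnion>T)) (q ` T)"
proof -
  have qT: "q ` T \<subseteq> carrier Q" using T by auto
  have sT: "\<Squnion>T \<in> carrier L" using T by simp
  have "q (\<Squnion>T) \<sqsubseteq>\<^bsub>Q\<^esub> q b"
    if b: "b \<in> carrier L" and le: "\<And>t. t \<in> T \<Longrightarrow> q t \<sqsubseteq>\<^bsub>Q\<^esub> q b" for b
  proof -
    have "(b \<sqinter> t, t) \<in> C" if "t \<in> T" for t
      using le[OF that] T(1) that b by (metis meet_comm quotient_le_iff subsetD)
    then have "(\<Squnion>((\<lambda>t. b \<sqinter> t) ` T), \<Squnion>((\<lambda>t. t) ` T)) \<in> C"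
      by (rule kappa_congruence_sup_image[OF congruence T(2)])
    then have "(\<Squnion>T \<sqinter> b, \<Squnion>T) \<in> C"
      using b T by (simp add: meet_kappa_sup_distrib meet_comm[where x = "\<Squnion>T"])
    then show ?thesis using b sT by (simp add: quotient_le_iff)
  qed
  moreover have "q t \<sqsubseteq>\<^bsub>Q\<^esub> q (\<Squnion>T)" if "t \<in> T" for t
    using T that sT by (intro quotient_map_mono sup_upper) auto
  ultimately show ?thesis
    unfolding is_lub_iff[OF qT] using sT by (simp add: carrier_quotient)
qed

text \<open>
  Choosing one representative for each class does not increase the cardinality; this is what lets
  \<open>\<kappa>\<close>-joins in the quotient be computed in \<open>L\<close>.
\<close>

lemma quotient_kappa_set_rep:
  assumes "\<A> \<subseteq> q ` I" "kappa_set \<kappa> \<A>"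
  obtains T where "T \<subseteq> I" "kappa_set \<kappa> T" "\<A> = q ` T"
proof
  show "inv_into I q ` \<A> \<subseteq> I" using assms(1) by (auto intro: inv_into_into)
  show "kappa_set \<kappa> (inv_into I q ` \<A>)" using assms(2) by (rule kappa_set_image)
  show "\<A> = q ` inv_into I q ` \<A>"
    using assms(1) by (auto simp: f_inv_into_f image_iff subset_iff)
qed

lemma quotient_kappa_frame: "kappa_frame \<kappa> Q"
proof (rule kappa_frameI[OF regular quotient_partial_order])
  interpret Q: partial_order Q by (rule quotient_partial_order)
  show "q \<top> \<in> carrier Q" by simp
  show "x \<sqsubseteq>\<^bsub>Q\<^esub> q \<top>" if "x \<in> carrier Q" for x
    using that by (auto simp: carrier_quotient intro!: quotient_map_mono)
  show "\<exists>m. is_glb Q m {x, y}" if "x \<in> carrier Q" "y \<in> carrier Q" for x y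
    using that quotient_is_glb unfolding carrier_quotient by blast
  show "\<exists>s. is_lub Q s \<A>" if "\<A> \<subseteq> carrier Q" "kappa_set \<kappa> \<A>" for \<A>
    using that quotient_is_lub unfolding carrier_quotient
    by (metis quotient_kappa_set_rep)
  show "x \<sqinter>\<^bsub>Q\<^esub> s \<sqsubseteq>\<^bsub>Q\<^esub> u"
    if x: "x \<in> carrier Q" and \<A>: "\<A> \<subseteq> carrier Q" "kappa_set \<kappa> \<A>" and s: "is_lub Q s \<A>"
      and u: "u \<in> carrier Q" and le: "\<And>a. a \<in> \<A> \<Longrightarrow> x \<sqinter>\<^bsub>Q\<^esub> a \<sqsubseteq>\<^bsub>Q\<^esub> u"
    for x \<A> s u
  proof -
    obtain a where a: "a \<in> carrier L" "x = q a" using x unfolding carrier_quotient by blast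
    obtain T where T: "T \<subseteq> carrier L" "kappa_set \<kappa> T" "\<A> = q ` T"
      using quotient_kappa_set_rep \<A> unfolding carrier_quotient by metis
    have st: "s = q (\<Squnion>T)"
      using Q.least_unique[OF s] quotient_is_lub[OF T(1,2)] T(3) by simp
    have sT: "\<Squnion>T \<in> carrier L" using T by simp
    let ?M = "(\<lambda>t. a \<sqinter> t) ` T"
    have M: "?M \<subseteq> carrier L" "kappa_set \<kappa> ?M" using T a by (auto simp: kappa_set_image)
    have qm: "q a \<sqinter>\<^bsub>Q\<^esub> q b = q (a \<sqinter> b)" if "b \<in> carrier L" for b
      by (rule Q.meet_eqI[OF quotient_is_glb[OF a(1) that]])
    have "q (a \<sqinter> t) \<sqsubseteq>\<^bsub>Q\<^esub> u" if "t \<in> T" for t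
      using le[of "q t"] that T qm[of t] a by auto
    then have "u \<in> Upper Q (q ` ?M)" using u by (intro Upper_memI) auto
    then have "q (\<Squnion>?M) \<sqsubseteq>\<^bsub>Q\<^esub> u" by (rule least_le[OF quotient_is_lub[OF M]])
    then show ?thesis
      using a T by (simp add: st qm[OF sT] meet_kappa_sup_distrib)
  qed
qed

sublocale Q: regular_kappa_frame \<kappa> Q
  by (intro regular_kappa_frame.intro quotient_kappa_frame regular_kappa_frame_axioms.intro regular)

lemma quotient_map_top: "q \<top> = \<top>\<^bsub>Q\<^esub>"
  by (rule Q.top_eqI[symmetric]) (auto simp: carrier_quotient intro!: quotient_map_mono)

lemma quotient_map_meet:
  "\<lbrakk>a \<in> carrier L; b \<in> carrier L\<rbrakk> \<Longrightarrow> q (a \<sqinter> b) = q a \<sqinter>\<^bsub>Q\<^esub> q b"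
  using Q.meet_eqI[OF quotient_is_glb] by simp

lemma quotient_map_sup:
  "\<lbrakk>T \<subseteq> carrier L; kappa_set \<kappa> T\<rbrakk> \<Longrightarrow> q (\<Squnion>T) = \<Squnion>\<^bsub>Q\<^esub>(q ` T)"
  using Q.sup_eqI[OF quotient_is_lub] by simp

end

lemma frame_homI:
  assumes A: "frame A" and B: "frame B"
    and "f \<in> carrier A \<rightarrow> carrier B" "f \<top>\<^bsub>A\<^esub> = \<top>\<^bsub>B\<^esub>"
    and "\<And>x y. \<lbrakk>x \<in> carrier A; y \<in> carrier A\<rbrakk> \<Longrightarrow> f (x \<sqinter>\<^bsub>A\<^esub> y) = f x \<sqinter>\<^bsub>B\<^esub> f y"
    and "\<And>S. S \<subseteq> carrier A \<Longrightarrow> f (\<Squnion>\<^bsub>A\<^esub> S) = \<Squnion>\<^bsub>B\<^esub> (f ` S)"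
  shows "frame_hom A B f"
proof -
  interpret A: kappa_frame infty A by (rule A)
  interpret B: kappa_frame infty B by (rule B)
  show ?thesis
    using assms frame_complete_lattice[OF A] frame_complete_lattice[OF B]
      A.lattice_axioms B.lattice_axioms
    unfolding frame_hom_def meet_pres_def sup_pres_def by simp
qed

lemma quotient_map_frame_hom:
  assumes A: "frame A" and C: "kappa_congruence infty A C"
  shows "frame_hom A (quotient_lattice A C) (quotient_map C)"
proof -
  interpret kappa_frame infty A by (rule A)
  interpret kappa_frame_with_congruence infty A C
    by unfold_locales (simp_all add: C)
  show ?thesis
    by (rule frame_homI[OF A quotient_kappa_frame])
      (auto simp: quotient_map_top quotient_map_meet quotient_map_sup)
qed

section \<open>The embedding of congruences\<close>

text \<open>
  The kernel of the map from the \<open>\<kappa>\<close>-ideals of \<open>L\<close> to those of \<open>L/C\<close>: two ideals have the same image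
  exactly if they have the same saturation.
\<close>

definition ideal_congruence ::
    "'k rel option \<Rightarrow> ('a, 'b) gorder_scheme \<Rightarrow> 'a rel \<Rightarrow> 'a set rel" where
  "ideal_congruence \<kappa> L C = {(I, J). kappa_ideal \<kappa> L I \<and> kappa_ideal \<kappa> L J \<and> C `` I = C `` J}"

context regular_kappa_frame
begin

lemma ideal_frame_regular: "regular_kappa_frame infty (ideal_frame \<kappa> L)"
  by (intro regular_kappa_frame.intro ideal_frame_frame regular_kappa_frame_axioms.intro) simp

interpretation H: regular_kappa_frame infty "ideal_frame \<kappa> L"
  by (rule ideal_frame_regular)

lemma principal_iff: "x \<in> principal L a \<longleftrightarrow> x \<in> carrier L \<and> x \<sqsubseteq> a"
  by (simp add: principal_def)

lemma kappa_ideal_principal: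
  assumes "a \<in> carrier L"
  shows "kappa_ideal \<kappa> L (principal L a)"
  unfolding kappa_ideal_def
proof (intro conjI ballI allI impI)
  show "y \<in> principal L a" if "x \<in> principal L a" "y \<in> carrier L" "y \<sqsubseteq> x" for x y
    using that assms le_trans[of y x a] by (simp add: principal_iff)
  show "\<Squnion>S \<in> principal L a" if "S \<subseteq> principal L a" "kappa_set \<kappa> S" for S
  proof -
    have "S \<subseteq> carrier L" using that(1) by (auto simp: principal_iff)
    then show ?thesis
      using that assms sup_least[of S a] by (auto simp: principal_iff subset_iff)
  qed
qed (simp add: principal_def)

lemma principal_subset_iff:
  assumes I: "kappa_ideal \<kappa> L I" and a: "a \<in> carrier L"
  shows "principal L a \<subseteq> I \<longleftrightarrow> a \<in> I"
proof
  show "a \<in> I" if "principal L a \<subseteq> I" using that a by (auto simp: principal_iff subset_iff)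
  show "principal L a \<subseteq> I" if "a \<in> I"
    using kappa_ideal_down[OF I that] by (simp add: principal_iff subset_iff)
qed

lemma principal_top: "principal L \<top> = carrier L"
  by (auto simp: principal_def)

lemma principal_meet:
  assumes "a \<in> carrier L" "b \<in> carrier L"
  shows "principal L (a \<sqinter> b) = principal L a \<inter> principal L b"
proof -
  have "x \<sqsubseteq> a \<sqinter> b \<longleftrightarrow> x \<sqsubseteq> a \<and> x \<sqsubseteq> b" if x: "x \<in> carrier L" for x
  proof (intro iffI conjI)
    show "x \<sqsubseteq> a" if "x \<sqsubseteq> a \<sqinter> b" by (rule le_trans[OF that meet_left]) (use x assms in simp_all)
    show "x \<sqsubseteq> b" if "x \<sqsubseteq> a \<sqinter> b" by (rule le_trans[OF that meet_right]) (use x assms in simp_all)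
    show "x \<sqsubseteq> a \<sqinter> b" if "x \<sqsubseteq> a \<and> x \<sqsubseteq> b" using that x assms by (simp add: meet_le)
  qed
  then show ?thesis by (auto simp: principal_def)
qed

lemma principal_sup:
  assumes T: "T \<subseteq> carrier L" "kappa_set \<kappa> T"
  shows "\<Squnion>\<^bsub>ideal_frame \<kappa> L\<^esub> (principal L ` T) = principal L (\<Squnion>T)"
proof -
  have sT: "\<Squnion>T \<in> carrier L" using T by simp
  have Tp: "principal L ` T \<subseteq> carrier (ideal_frame \<kappa> L)"
    using T kappa_ideal_principal by (auto simp: carrier_ideal_frame)
  have "t \<in> principal L (\<Squnion>T)" if "t \<in> T" for t
    using that T sup_upper[OF T that] by (auto simp: principal_iff)
  moreover have "\<Squnion>T \<in> I" if "kappa_ideal \<kappa> L I" "\<And>t. t \<in> T \<Longrightarrow> t \<in> I" for I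
    using that T(2) by (intro kappa_ideal_sup) auto
  ultimately have "is_lub (ideal_frame \<kappa> L) (principal L (\<Squnion>T)) (principal L ` T)"
    unfolding is_lub_iff[OF Tp] using T sT
    by (simp add: carrier_ideal_frame le_ideal_frame kappa_ideal_principal principal_subset_iff subset_iff[of T])
  then show ?thesis by (rule H.sup_eqI)
qed

lemma ideal_eq_sup_principal:
  assumes I: "kappa_ideal \<kappa> L I"
  shows "\<Squnion>\<^bsub>ideal_frame \<kappa> L\<^esub> (principal L ` I) = I"
proof (rule H.sup_eqI)
  have c: "a \<in> carrier L" if "a \<in> I" for a using that kappa_ideal_subset[OF I] by blast
  have Ip: "principal L ` I \<subseteq> carrier (ideal_frame \<kappa> L)"
    using c kappa_ideal_principal by (auto simp: carrier_ideal_frame)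
  show "is_lub (ideal_frame \<kappa> L) I (principal L ` I)"
    unfolding is_lub_iff[OF Ip] using c I
    by (simp add: carrier_ideal_frame le_ideal_frame principal_subset_iff subset_iff[of I])
qed

lemma ideal_congruence_iff:
  assumes C: "kappa_congruence \<kappa> L C"
  shows "(I, J) \<in> ideal_congruence \<kappa> L C \<longleftrightarrow> kappa_ideal \<kappa> L I \<and> kappa_ideal \<kappa> L J \<and>
    (\<forall>a\<in>I. \<exists>b\<in>J. (a, b) \<in> C) \<and> (\<forall>b\<in>J. \<exists>a\<in>I. (a, b) \<in> C)"
proof (cases "kappa_ideal \<kappa> L I \<and> kappa_ideal \<kappa> L J")
  case True
  then have c: "I \<subseteq> carrier L" "J \<subseteq> carrier L"
    using kappa_ideal_subset[of \<kappa> L I] kappa_ideal_subset[of \<kappa> L J] by simp_all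
  note refl = kappa_congruence_refl[OF C] and sym = kappa_congruence_sym[OF C]
    and trans = kappa_congruence_trans[OF C]
  have sub: "C `` I \<subseteq> C `` J \<longleftrightarrow> (\<forall>a\<in>I. \<exists>b\<in>J. (a, b) \<in> C)" if "I \<subseteq> carrier L" for I J
  proof
    assume le: "C `` I \<subseteq> C `` J"
    show "\<forall>a\<in>I. \<exists>b\<in>J. (a, b) \<in> C"
    proof
      fix a assume "a \<in> I"
      then have "a \<in> C `` I" using refl that by blast
      then show "\<exists>b\<in>J. (a, b) \<in> C" using le sym by blast
    qed
  next
    assume le: "\<forall>a\<in>I. \<exists>b\<in>J. (a, b) \<in> C"
    show "C `` I \<subseteq> C `` J"
    proof
      fix x assume "x \<in> C `` I"
      then obtain a where a: "a \<in> I" "(a, x) \<in> C" by blast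
      then obtain b where "b \<in> J" "(a, b) \<in> C" using le by blast
      then show "x \<in> C `` J" using trans[OF sym a(2)] by blast
    qed
  qed
  have "C `` I = C `` J \<longleftrightarrow> (\<forall>a\<in>I. \<exists>b\<in>J. (a, b) \<in> C) \<and> (\<forall>b\<in>J. \<exists>a\<in>I. (b, a) \<in> C)"
    using sub[OF c(1), of J] sub[OF c(2), of I] by (simp add: set_eq_subset)
  moreover have "(b, a) \<in> C \<longleftrightarrow> (a, b) \<in> C" for a b using sym by blast
  ultimately show ?thesis using True by (simp add: ideal_congruence_def)
qed (auto simp: ideal_congruence_def)

text \<open>
  An element below a \<open>\<kappa>\<close>-join of elements of the first ideals stays in its \<open>C\<close>-class when those elements are
  replaced by congruent elements of the second ideals; this gives the closure under arbitrary joins.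
\<close>

lemma ideal_congruence_congruence:
  assumes C: "kappa_congruence \<kappa> L C"
  shows "kappa_congruence infty (ideal_frame \<kappa> L) (ideal_congruence \<kappa> L C)"
    (is "kappa_congruence infty ?H ?K")
proof (rule H.kappa_congruenceI)
  note K = ideal_congruence_iff[OF C]
  show "I \<in> carrier ?H \<and> J \<in> carrier ?H" if "(I, J) \<in> ?K" for I J
    using that by (simp add: ideal_congruence_def carrier_ideal_frame)
  show "(I, I) \<in> ?K" if "I \<in> carrier ?H" for I
    using that by (simp add: ideal_congruence_def carrier_ideal_frame)
  show "(J, I) \<in> ?K" if "(I, J) \<in> ?K" for I J
    using that by (simp add: ideal_congruence_def)
  show "(I, M) \<in> ?K" if "(I, J) \<in> ?K" "(J, M) \<in> ?K" for I J M
    using that by (simp add: ideal_congruence_def)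
  show "(I \<sqinter>\<^bsub>?H\<^esub> I', J \<sqinter>\<^bsub>?H\<^esub> J') \<in> ?K"
    if IJ: "(I, J) \<in> ?K" and IJ': "(I', J') \<in> ?K" for I J I' J'
  proof -
    have id: "kappa_ideal \<kappa> L I" "kappa_ideal \<kappa> L J" "kappa_ideal \<kappa> L I'" "kappa_ideal \<kappa> L J'"
      using IJ IJ' by (simp_all add: ideal_congruence_def)
    have "\<exists>b \<in> J \<inter> J'. (a, b) \<in> C"
      if J: "kappa_ideal \<kappa> L J" "\<forall>a\<in>I. \<exists>b\<in>J. (a, b) \<in> C"
        and J': "kappa_ideal \<kappa> L J'" "\<forall>a\<in>I'. \<exists>b\<in>J'. (a, b) \<in> C"
        and a: "a \<in> I" "a \<in> I'" for I J I' J' a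
    proof -
      obtain b b' where b: "b \<in> J" "(a, b) \<in> C" and b': "b' \<in> J'" "(a, b') \<in> C"
        using J(2) J'(2) a by blast
      have c: "a \<in> carrier L" "b \<in> carrier L" "b' \<in> carrier L"
        using kappa_congruence_carrier[OF C] b b' by auto
      have "(a, b \<sqinter> b') \<in> C"
        using kappa_congruence_meet[OF C b(2) b'(2)] c by (simp add: meet_idem)
      moreover have "b \<sqinter> b' \<in> J \<inter> J'"
        using kappa_ideal_meet[OF J(1) b(1) c(3)] kappa_ideal_meet[OF J'(1) b'(1) c(2)] by simp
      ultimately show ?thesis by blast
    qed
    note meet = this
    have sym: "(a, b) \<in> C \<longleftrightarrow> (b, a) \<in> C" for a b using kappa_congruence_sym[OF C] by blast
    have flip: "\<forall>b\<in>J. \<exists>a\<in>I. (b, a) \<in> C" "\<forall>b\<in>J'. \<exists>a\<in>I'. (b, a) \<in> C"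
      using IJ IJ' sym unfolding K by blast+
    have "\<forall>a\<in>I \<inter> I'. \<exists>b\<in>J \<inter> J'. (a, b) \<in> C"
      using meet[of J I J' I'] IJ IJ' unfolding K by blast
    moreover have "\<forall>b\<in>J \<inter> J'. \<exists>a\<in>I \<inter> I'. (a, b) \<in> C"
      using meet[OF id(1) flip(1) id(3) flip(2)] sym by blast
    ultimately show ?thesis
      using id by (simp add: ideal_frame_meet K kappa_ideal_Int)
  qed
  show "(\<Squnion>\<^bsub>?H\<^esub>(fst ` S), \<Squnion>\<^bsub>?H\<^esub>(snd ` S)) \<in> ?K" if S: "S \<subseteq> ?K" for S
  proof -
    have id: "kappa_ideal \<kappa> L I" "kappa_ideal \<kappa> L J" if "(I, J) \<in> S" for I J
      using S that by (auto simp: ideal_congruence_def)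
    have sup_subset: "C `` (\<Squnion>\<^bsub>?H\<^esub> \<I>) \<subseteq> C `` (\<Squnion>\<^bsub>?H\<^esub> \<J>)"
      if \<I>: "\<I> \<subseteq> {I. kappa_ideal \<kappa> L I}" and \<J>: "\<J> \<subseteq> {J. kappa_ideal \<kappa> L J}"
        and IJ: "\<And>I. I \<in> \<I> \<Longrightarrow> \<exists>J\<in>\<J>. (I, J) \<in> ?K" for \<I> \<J>
    proof
      fix z assume "z \<in> C `` (\<Squnion>\<^bsub>?H\<^esub> \<I>)"
      then obtain x where x: "x \<in> \<Squnion>\<^bsub>?H\<^esub> \<I>" "(x, z) \<in> C" by blast
      then obtain T where xc: "x \<in> carrier L" and T: "T \<subseteq> \<Union>\<I>" "kappa_set \<kappa> T" "x \<sqsubseteq> \<Squnion>T"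
        unfolding ideal_frame_sup[OF \<I>] by blast
      have "\<exists>u \<in> \<Union>\<J>. (t, u) \<in> C" if t: "t \<in> T" for t
      proof -
        obtain I where I: "t \<in> I" "I \<in> \<I>" using T(1) t by blast
        then show ?thesis using IJ[OF I(2)] unfolding K by blast
      qed
      then obtain u where u: "\<And>t. t \<in> T \<Longrightarrow> u t \<in> \<Union>\<J> \<and> (t, u t) \<in> C" by metis
      have c: "T \<subseteq> carrier L" "u ` T \<subseteq> carrier L"
        using u kappa_congruence_carrier[OF C] by fast+
      have k: "kappa_set \<kappa> (u ` T)" using T(2) by (rule kappa_set_image)
      have s: "\<Squnion>T \<in> carrier L" "\<Squnion>(u ` T) \<in> carrier L" using c k T(2) by simp_all
      have "(\<Squnion>T, \<Squnion>(u ` T)) \<in> C"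
        using kappa_congruence_sup_image[OF C T(2), of "\<lambda>t. t" u] u by simp
      then have "(x \<sqinter> \<Squnion>T, x \<sqinter> \<Squnion>(u ` T)) \<in> C"
        using kappa_congruence_meet[OF C kappa_congruence_refl[OF C xc]] by blast
      then have "(x \<sqinter> \<Squnion>(u ` T), z) \<in> C"
        using x(2) kappa_congruence_sym[OF C] kappa_congruence_trans[OF C] meet_absorb1[OF xc s(1) T(3)]
        by metis
      moreover have "x \<sqinter> \<Squnion>(u ` T) \<in> \<Squnion>\<^bsub>?H\<^esub> \<J>"
        unfolding ideal_frame_sup[OF \<J>]
      proof (intro CollectI conjI exI)
        show "x \<sqinter> \<Squnion>(u ` T) \<in> carrier L" using xc s by simp
        show "u ` T \<subseteq> \<Union>\<J>" using u by blast
        show "x \<sqinter> \<Squnion>(u ` T) \<sqsubseteq> \<Squnion>(u ` T)" using xc s by (simp add: meet_right)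
      qed (rule k)
      ultimately show "z \<in> C `` (\<Squnion>\<^bsub>?H\<^esub> \<J>)" by blast
    qed
    have fs: "fst ` S \<subseteq> {I. kappa_ideal \<kappa> L I}" "snd ` S \<subseteq> {J. kappa_ideal \<kappa> L J}"
      using id by auto
    have "C `` (\<Squnion>\<^bsub>?H\<^esub>(fst ` S)) \<subseteq> C `` (\<Squnion>\<^bsub>?H\<^esub>(snd ` S))"
    proof (rule sup_subset[OF fs])
      show "\<exists>J\<in>snd ` S. (I, J) \<in> ?K" if "I \<in> fst ` S" for I using that S by force
    qed
    moreover have "C `` (\<Squnion>\<^bsub>?H\<^esub>(snd ` S)) \<subseteq> C `` (\<Squnion>\<^bsub>?H\<^esub>(fst ` S))"
    proof (rule sup_subset[OF fs(2,1)])
      fix J assume "J \<in> snd ` S"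
      then obtain I where I: "(I, J) \<in> S" by force
      then have "(I, J) \<in> ?K" using S by blast
      then have "(J, I) \<in> ?K" by (simp add: ideal_congruence_def)
      then show "\<exists>I\<in>fst ` S. (J, I) \<in> ?K" using I by force
    qed
    moreover have "kappa_ideal \<kappa> L (\<Squnion>\<^bsub>?H\<^esub>(fst ` S))" "kappa_ideal \<kappa> L (\<Squnion>\<^bsub>?H\<^esub>(snd ` S))"
      using H.sup_closed[of "fst ` S"] H.sup_closed[of "snd ` S"] fs
      by (simp_all add: carrier_ideal_frame)
    ultimately show ?thesis by (simp add: ideal_congruence_def)
  qed
qed

text \<open>
  If \<open>a\<close> is congruent to some \<open>x \<sqsubseteq> b\<close>, then \<open>a \<sqinter> b\<close> is congruent to \<open>x \<sqinter> b = x\<close>, hence to \<open>a\<close>. Used on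
  both sides, this makes \<open>a\<close> and \<open>b\<close> congruent to \<open>a \<sqinter> b\<close>.
\<close>

lemma principal_ideal_congruence_iff:
  assumes C: "kappa_congruence \<kappa> L C" and a: "a \<in> carrier L" and b: "b \<in> carrier L"
  shows "(principal L a, principal L b) \<in> ideal_congruence \<kappa> L C \<longleftrightarrow> (a, b) \<in> C"
proof -
  note refl = kappa_congruence_refl[OF C] and sym = kappa_congruence_sym[OF C]
    and trans = kappa_congruence_trans[OF C] and meet = kappa_congruence_meet[OF C]
  have below: "(a \<sqinter> b, a) \<in> C" if c: "a \<in> carrier L" "b \<in> carrier L"
    and ex: "\<exists>x\<in>principal L b. (a, x) \<in> C" for a b
  proof -
    obtain x where x: "x \<in> carrier L" "x \<sqsubseteq> b" "(a, x) \<in> C"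
      using ex unfolding Bex_def principal_iff by (elim exE conjE)
    have "(a \<sqinter> b, x) \<in> C"
      using meet[OF x(3) refl[OF c(2)]] x c by (simp add: meet_absorb1)
    then show ?thesis using sym trans x(3) by blast
  qed
  have image: "\<exists>y\<in>principal L b. (x, y) \<in> C" if ab: "(a, b) \<in> C" and x: "x \<in> principal L a" for a b x
  proof
    have c: "a \<in> carrier L" "b \<in> carrier L" "x \<in> carrier L" "x \<sqsubseteq> a"
      using kappa_congruence_carrier[OF C ab] x by (simp_all add: principal_iff)
    show "(x, x \<sqinter> b) \<in> C" using meet[OF refl[OF c(3)] ab] c by (simp add: meet_absorb1)
    show "x \<sqinter> b \<in> principal L b" using c by (simp add: principal_iff meet_right)
  qed
  show ?thesis
  proof
    assume K: "(principal L a, principal L b) \<in> ideal_congruence \<kappa> L C"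
    then have K': "(principal L b, principal L a) \<in> ideal_congruence \<kappa> L C"
      by (simp add: ideal_congruence_def)
    have self: "a \<in> principal L a" "b \<in> principal L b" using a b by (simp_all add: principal_iff)
    have "(a \<sqinter> b, a) \<in> C"
      using K self unfolding ideal_congruence_iff[OF C] by (intro below a b) blast
    moreover have "(b \<sqinter> a, b) \<in> C"
      using K' self unfolding ideal_congruence_iff[OF C] by (intro below a b) blast
    ultimately show "(a, b) \<in> C" using sym trans by (metis meet_comm)
  next
    assume ab: "(a, b) \<in> C"
    have "\<forall>x\<in>principal L a. \<exists>y\<in>principal L b. (x, y) \<in> C"
      using image[OF ab] by blast
    moreover have "\<forall>y\<in>principal L b. \<exists>x\<in>principal L a. (x, y) \<in> C"
      using image[OF sym[OF ab]] sym by blast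
    ultimately show "(principal L a, principal L b) \<in> ideal_congruence \<kappa> L C"
      using a b by (simp add: ideal_congruence_iff[OF C] kappa_ideal_principal)
  qed
qed

text \<open>
  For related ideals \<open>I\<close> and \<open>J\<close>, the pairs in \<open>C \<inter> I \<times> J\<close> project onto both \<open>I\<close> and \<open>J\<close>. So one join of
  pairs \<open>(\<down>a, \<down>b)\<close> in \<open>D\<close> produces the pair \<open>(I, J)\<close>.
\<close>

lemma ideal_congruence_least:
  assumes C: "kappa_congruence \<kappa> L C" and D: "kappa_congruence infty (ideal_frame \<kappa> L) D"
    and CD: "\<And>a b. (a, b) \<in> C \<Longrightarrow> (principal L a, principal L b) \<in> D"
  shows "ideal_congruence \<kappa> L C \<subseteq> D"
proof
  fix p assume p: "p \<in> ideal_congruence \<kappa> L C"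
  obtain I J where pIJ: "p = (I, J)" by (cases p)
  have I: "kappa_ideal \<kappa> L I" and J: "kappa_ideal \<kappa> L J"
    and IJ: "\<forall>a\<in>I. \<exists>b\<in>J. (a, b) \<in> C" "\<forall>b\<in>J. \<exists>a\<in>I. (a, b) \<in> C"
    using p unfolding pIJ ideal_congruence_iff[OF C] by auto
  let ?S = "(\<lambda>(a, b). (principal L a, principal L b)) ` (C \<inter> I \<times> J)"
  have "fst ` ?S = principal L ` I" "snd ` ?S = principal L ` J"
    using IJ by (force simp: image_iff)+
  moreover have "?S \<subseteq> D" using CD by auto
  ultimately have "(\<Squnion>\<^bsub>ideal_frame \<kappa> L\<^esub>(principal L ` I), \<Squnion>\<^bsub>ideal_frame \<kappa> L\<^esub>(principal L ` J)) \<in> D"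
    using kappa_congruence_sup[OF D, of ?S] by simp
  then show "p \<in> D" by (simp add: pIJ ideal_eq_sup_principal I J)
qed

lemma cong_embedding_eq:
  assumes C: "kappa_congruence \<kappa> L C"
  shows "cong_embedding \<kappa> L C = ideal_congruence \<kappa> L C"
proof
  let ?R = "{(principal L a, principal L b) | a b. (a, b) \<in> C}"
  have "?R \<subseteq> ideal_congruence \<kappa> L C"
    using kappa_congruence_carrier[OF C] by (auto simp: principal_ideal_congruence_iff[OF C])
  then show "cong_embedding \<kappa> L C \<subseteq> ideal_congruence \<kappa> L C"
    unfolding cong_embedding_def generated_frame_congruence_def
    using ideal_congruence_congruence[OF C] by (intro Inter_lower) simp
  show "ideal_congruence \<kappa> L C \<subseteq> cong_embedding \<kappa> L C"
    unfolding cong_embedding_def generated_frame_congruence_def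
  proof (rule Inter_greatest)
    fix D assume "D \<in> {D. kappa_congruence infty (ideal_frame \<kappa> L) D \<and> ?R \<subseteq> D}"
    then show "ideal_congruence \<kappa> L C \<subseteq> D"
      by (intro ideal_congruence_least[OF C]) auto
  qed
qed

lemma ideal_congruence_mono:
  assumes "kappa_congruence \<kappa> L C" "kappa_congruence \<kappa> L D" "C \<subseteq> D"
  shows "ideal_congruence \<kappa> L C \<subseteq> ideal_congruence \<kappa> L D"
proof
  fix p assume "p \<in> ideal_congruence \<kappa> L C"
  then show "p \<in> ideal_congruence \<kappa> L D"
    using assms(3) ideal_congruence_iff[OF assms(1)] ideal_congruence_iff[OF assms(2)]
    by (cases p) (simp, blast)
qed

text \<open>
  The substance is that two witnesses in \<open>J\<close>, one congruent to \<open>a\<close> under \<open>C\<close> and one under \<open>D\<close>, can be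
  merged into one that works for both.
\<close>

lemma ideal_congruence_Int:
  assumes C: "kappa_congruence \<kappa> L C" and D: "kappa_congruence \<kappa> L D"
  shows "ideal_congruence \<kappa> L (C \<inter> D) = ideal_congruence \<kappa> L C \<inter> ideal_congruence \<kappa> L D"
proof
  note CD = kappa_congruence_Int[OF C D]
  show "ideal_congruence \<kappa> L (C \<inter> D) \<subseteq> ideal_congruence \<kappa> L C \<inter> ideal_congruence \<kappa> L D"
    using ideal_congruence_mono[OF CD C] ideal_congruence_mono[OF CD D] by blast
  have common: "\<exists>c\<in>J. (a, c) \<in> C \<inter> D"
    if J: "kappa_ideal \<kappa> L J" and b: "b \<in> J" "(a, b) \<in> C" and b': "b' \<in> J" "(a, b') \<in> D" for J a b b'
  proof
    have c: "a \<in> carrier L" "b \<in> carrier L" "b' \<in> carrier L"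
      using kappa_congruence_carrier[OF C b(2)] kappa_congruence_carrier[OF D b'(2)] by auto
    \<comment> \<open>Replacing \<open>b\<close> by \<open>a\<close> under \<open>C\<close>, or \<open>b'\<close> by \<open>a\<close> under \<open>D\<close>, turns \<open>a \<sqinter> (b \<squnion> b')\<close> into \<open>a\<close> by absorption.\<close>
    have "(a \<sqinter> (a \<squnion> b'), a \<sqinter> (b \<squnion> b')) \<in> C"
      using kappa_congruence_refl[OF C] c b
      by (intro kappa_congruence_meet[OF C] kappa_congruence_join[OF C]) auto
    moreover have "(a \<sqinter> (b \<squnion> a), a \<sqinter> (b \<squnion> b')) \<in> D"
      using kappa_congruence_refl[OF D] c b'
      by (intro kappa_congruence_meet[OF D] kappa_congruence_join[OF D]) auto
    ultimately show "(a, a \<sqinter> (b \<squnion> b')) \<in> C \<inter> D"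
      using c by (simp add: meet_join_absorb join_comm[where x = b and y = a])
    show "a \<sqinter> (b \<squnion> b') \<in> J"
      using kappa_ideal_meet[OF J kappa_ideal_join[OF J b(1) b'(1)] c(1)] by simp
  qed
  have sym: "(a, b) \<in> E \<longleftrightarrow> (b, a) \<in> E" if "kappa_congruence \<kappa> L E" for E a b
    using kappa_congruence_sym[OF that] by blast
  show "ideal_congruence \<kappa> L C \<inter> ideal_congruence \<kappa> L D \<subseteq> ideal_congruence \<kappa> L (C \<inter> D)"
  proof
    fix p assume p: "p \<in> ideal_congruence \<kappa> L C \<inter> ideal_congruence \<kappa> L D"
    obtain I J where pIJ: "p = (I, J)" by (cases p)
    have I: "kappa_ideal \<kappa> L I" and J: "kappa_ideal \<kappa> L J"
      and 1: "\<And>a. a \<in> I \<Longrightarrow> \<exists>b\<in>J. (a, b) \<in> C" "\<And>a. a \<in> I \<Longrightarrow> \<exists>b\<in>J. (a, b) \<in> D"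
      and 2: "\<And>b. b \<in> J \<Longrightarrow> \<exists>a\<in>I. (a, b) \<in> C" "\<And>b. b \<in> J \<Longrightarrow> \<exists>a\<in>I. (a, b) \<in> D"
      using p unfolding pIJ Int_iff ideal_congruence_iff[OF C] ideal_congruence_iff[OF D] by auto
    have "\<exists>b\<in>J. (a, b) \<in> C \<inter> D" if "a \<in> I" for a
      using 1[OF that] common[OF J] by blast
    moreover have "\<exists>a\<in>I. (a, b) \<in> C \<inter> D" if b: "b \<in> J" for b
    proof -
      obtain a a' where "a \<in> I" "(b, a) \<in> C" "a' \<in> I" "(b, a') \<in> D"
        using 2[OF b] sym[OF C] sym[OF D] by blast
      then show ?thesis using common[OF I] sym[OF CD] by blast
    qed
    ultimately show "p \<in> ideal_congruence \<kappa> L (C \<inter> D)"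
      unfolding pIJ ideal_congruence_iff[OF CD] using I J by blast
  qed
qed

lemma ideal_congruence_total:
  "ideal_congruence \<kappa> L (carrier L \<times> carrier L) = carrier (ideal_frame \<kappa> L) \<times> carrier (ideal_frame \<kappa> L)"
proof -
  have "(carrier L \<times> carrier L) `` I = carrier L" if I: "kappa_ideal \<kappa> L I" for I
  proof -
    \<comment> \<open>Ideals are nonempty because they contain the empty join.\<close>
    have "\<Squnion>{} \<in> I" using kappa_ideal_sup[OF I, of "{}"] by simp
    then have "I \<inter> carrier L \<noteq> {}" using kappa_ideal_subset[OF I] by blast
    then show ?thesis by blast
  qed
  then show ?thesis by (auto simp: ideal_congruence_def carrier_ideal_frame)
qed

text \<open>
  This restriction is right adjoint to \<open>\<iota>\<close>. It is a \<open>\<kappa>\<close>-congruence because \<open>a \<mapsto> \<down>a\<close> preserves finite meets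
  and \<open>\<kappa>\<close>-joins.
\<close>

lemma principal_pullback_congruence:
  assumes D: "kappa_congruence infty (ideal_frame \<kappa> L) D"
  shows "kappa_congruence \<kappa> L
    {(a, b). a \<in> carrier L \<and> b \<in> carrier L \<and> (principal L a, principal L b) \<in> D}" (is "kappa_congruence \<kappa> L ?E")
proof (rule kappa_congruenceI)
  show "(a, a) \<in> ?E" if "a \<in> carrier L" for a
    using that kappa_congruence_refl[OF D] kappa_ideal_principal by (simp add: carrier_ideal_frame)
  show "(b, a) \<in> ?E" if "(a, b) \<in> ?E" for a b
    using that kappa_congruence_sym[OF D] by simp
  show "(a, c) \<in> ?E" if "(a, b) \<in> ?E" "(b, c) \<in> ?E" for a b c
    using that kappa_congruence_trans[OF D] by blast
  show "(a \<sqinter> c, b \<sqinter> d) \<in> ?E" if "(a, b) \<in> ?E" "(c, d) \<in> ?E" for a b c d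
    using that kappa_congruence_meet[OF D, of "principal L a" "principal L b" "principal L c" "principal L d"]
    by (simp add: principal_meet ideal_frame_meet kappa_ideal_principal)
  show "(\<Squnion>(fst ` S), \<Squnion>(snd ` S)) \<in> ?E" if S: "S \<subseteq> ?E" "kappa_set \<kappa> S" for S
  proof -
    have c: "fst ` S \<subseteq> carrier L" "snd ` S \<subseteq> carrier L" using S(1) by auto
    have k: "kappa_set \<kappa> (fst ` S)" "kappa_set \<kappa> (snd ` S)" using S(2) by (simp_all add: kappa_set_image)
    have "(\<Squnion>\<^bsub>ideal_frame \<kappa> L\<^esub>((\<lambda>p. principal L (fst p)) ` S),
        \<Squnion>\<^bsub>ideal_frame \<kappa> L\<^esub>((\<lambda>p. principal L (snd p)) ` S)) \<in> D"
      using S(1) by (intro kappa_congruence_sup_image[OF D]) auto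
    then show ?thesis
      using principal_sup[OF c(1) k(1)] principal_sup[OF c(2) k(2)] c k by (simp add: image_image)
  qed
qed simp

lemma cong_embedding_frame_hom:
  "frame_hom (congruence_frame \<kappa> L) (congruence_frame infty (ideal_frame \<kappa> L)) (cong_embedding \<kappa> L)"
proof (rule frame_homI[OF congruence_frame_frame H.congruence_frame_frame])
  let ?A = "congruence_frame \<kappa> L" and ?B = "congruence_frame infty (ideal_frame \<kappa> L)"
  have A: "carrier ?A = {C. kappa_congruence \<kappa> L C}"
    and B: "carrier ?B = {C. kappa_congruence infty (ideal_frame \<kappa> L) C}"
    by (simp_all add: congruence_frame_def)
  show "cong_embedding \<kappa> L \<in> carrier ?A \<rightarrow> carrier ?B"
    by (simp add: A B cong_embedding_eq ideal_congruence_congruence)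
  show "cong_embedding \<kappa> L \<top>\<^bsub>?A\<^esub> = \<top>\<^bsub>?B\<^esub>"
    by (simp add: congruence_frame_top H.congruence_frame_top cong_embedding_eq
        kappa_congruence_total ideal_congruence_total)
  show "cong_embedding \<kappa> L (C \<sqinter>\<^bsub>?A\<^esub> D) = cong_embedding \<kappa> L C \<sqinter>\<^bsub>?B\<^esub> cong_embedding \<kappa> L D"
    if "C \<in> carrier ?A" "D \<in> carrier ?A" for C D
    using that
    by (simp add: A congruence_frame_meet H.congruence_frame_meet cong_embedding_eq
        kappa_congruence_Int ideal_congruence_congruence ideal_congruence_Int)
  show "cong_embedding \<kappa> L (\<Squnion>\<^bsub>?A\<^esub> \<C>) = \<Squnion>\<^bsub>?B\<^esub>(cong_embedding \<kappa> L ` \<C>)" if "\<C> \<subseteq> carrier ?A" for \<C>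
  proof -
    have \<C>: "kappa_congruence \<kappa> L C" if "C \<in> \<C>" for C using that \<open>\<C> \<subseteq> _\<close> by (auto simp: A)
    define G where "G = \<Squnion>\<^bsub>?A\<^esub> \<C>"
    have G_eq: "G = \<Inter>{D. kappa_congruence \<kappa> L D \<and> \<Union>\<C> \<subseteq> D}"
      unfolding G_def by (rule congruence_frame_sup[OF \<C>])
    interpret A: kappa_frame infty ?A by (rule congruence_frame_frame)
    have "is_lub ?A G \<C>"
      using A.kappa_sup_exists[OF \<open>\<C> \<subseteq> _\<close>] A.sup_eqI unfolding G_def by force
    then have G: "kappa_congruence \<kappa> L G" using A least_closed by blast
    have img: "cong_embedding \<kappa> L ` \<C> = ideal_congruence \<kappa> L ` \<C>"
      using \<C> by (auto simp: cong_embedding_eq image_iff)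
    have "ideal_congruence \<kappa> L G = \<Inter>{D. kappa_congruence infty (ideal_frame \<kappa> L) D \<and>
        \<Union>(ideal_congruence \<kappa> L ` \<C>) \<subseteq> D}" (is "_ = \<Inter>?\<D>")
    proof
      show "\<Inter>?\<D> \<subseteq> ideal_congruence \<kappa> L G"
      proof (rule Inter_lower)
        have "ideal_congruence \<kappa> L C \<subseteq> ideal_congruence \<kappa> L G" if "C \<in> \<C>" for C
          using that by (intro ideal_congruence_mono \<C> G) (auto simp: G_eq)
        then show "ideal_congruence \<kappa> L G \<in> ?\<D>" using ideal_congruence_congruence[OF G] by blast
      qed
      show "ideal_congruence \<kappa> L G \<subseteq> \<Inter>?\<D>"
      proof (rule Inter_greatest)
        fix D assume "D \<in> ?\<D>"
        then have D: "kappa_congruence infty (ideal_frame \<kappa> L) D"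
          and CD: "\<And>C. C \<in> \<C> \<Longrightarrow> ideal_congruence \<kappa> L C \<subseteq> D" by auto
        let ?E = "{(a, b). a \<in> carrier L \<and> b \<in> carrier L \<and> (principal L a, principal L b) \<in> D}"
        have "C \<subseteq> ?E" if "C \<in> \<C>" for C
          using CD[OF that] kappa_congruence_carrier[OF \<C>[OF that]]
            principal_ideal_congruence_iff[OF \<C>[OF that]] by blast
        then have "G \<subseteq> ?E"
          unfolding G_eq using principal_pullback_congruence[OF D] by (intro Inter_lower) auto
        then show "ideal_congruence \<kappa> L G \<subseteq> D"
          by (intro ideal_congruence_least[OF G D]) blast
      qed
    qed
    also have "\<dots> = \<Squnion>\<^bsub>?B\<^esub>(ideal_congruence \<kappa> L ` \<C>)"
      by (rule H.congruence_frame_sup[symmetric]) (auto intro: ideal_congruence_congruence \<C>)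
    finally show ?thesis using cong_embedding_eq[OF G] by (simp add: G_def img)
  qed
qed

lemma cong_embedding_inj: "inj_on (cong_embedding \<kappa> L) (carrier (congruence_frame \<kappa> L))"
proof (rule inj_onI)
  fix C D assume "C \<in> carrier (congruence_frame \<kappa> L)" "D \<in> carrier (congruence_frame \<kappa> L)"
    and eq: "cong_embedding \<kappa> L C = cong_embedding \<kappa> L D"
  then have C: "kappa_congruence \<kappa> L C" and D: "kappa_congruence \<kappa> L D"
    by (simp_all add: congruence_frame_def)
  have "(a, b) \<in> C \<longleftrightarrow> (a, b) \<in> D" if "a \<in> carrier L" "b \<in> carrier L" for a b
    using eq principal_ideal_congruence_iff[OF C that] principal_ideal_congruence_iff[OF D that]
    by (simp add: cong_embedding_eq C D)
  then show "C = D"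
    using kappa_congruence_carrier[OF C] kappa_congruence_carrier[OF D]
    by (intro subset_antisym subrelI) blast+
qed

end


section \<open>Isomorphisms and \<kappa>-coherence\<close>

text \<open>
  Since meets and joins are determined by the order, order isomorphisms are the convenient form of frame
  isomorphisms: they only require the order of a quotient to be computed, not its joins.
\<close>

locale frame_order_iso = A: kappa_frame infty A + B: kappa_frame infty B
  for A :: "('a, 'c) gorder_scheme" and B :: "('b, 'd) gorder_scheme" +
  fixes f :: "'a \<Rightarrow> 'b"
  assumes bij: "bij_betw f (carrier A) (carrier B)"
    and le_iff: "\<lbrakk>x \<in> carrier A; y \<in> carrier A\<rbrakk> \<Longrightarrow> f x \<sqsubseteq>\<^bsub>B\<^esub> f y \<longleftrightarrow> x \<sqsubseteq>\<^bsub>A\<^esub> y"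
begin

sublocale A: regular_kappa_frame infty A by unfold_locales simp
sublocale B: regular_kappa_frame infty B by unfold_locales simp

lemma closed [simp]: "x \<in> carrier A \<Longrightarrow> f x \<in> carrier B"
  using bij by (auto simp: bij_betw_def)

lemma carrier_image: "carrier B = f ` carrier A"
  using bij by (simp add: bij_betw_def)

lemma iso_top: "f \<top>\<^bsub>A\<^esub> = \<top>\<^bsub>B\<^esub>"
  by (rule B.top_eqI[symmetric]) (auto simp: carrier_image le_iff)

lemma iso_meet:
  assumes "x \<in> carrier A" "y \<in> carrier A"
  shows "f (x \<sqinter>\<^bsub>A\<^esub> y) = f x \<sqinter>\<^bsub>B\<^esub> f y"
proof (rule B.meet_eqI[symmetric])
  show "is_glb B (f (x \<sqinter>\<^bsub>A\<^esub> y)) {f x, f y}"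
    using assms by (simp add: is_glb_iff carrier_image le_iff A.meet_left A.meet_right A.meet_le)
qed

lemma iso_sup:
  assumes S: "S \<subseteq> carrier A"
  shows "f (\<Squnion>\<^bsub>A\<^esub> S) = \<Squnion>\<^bsub>B\<^esub> (f ` S)"
proof (rule B.sup_eqI[symmetric])
  have fS: "f ` S \<subseteq> carrier B" using S by auto
  have "is_lub A (\<Squnion>\<^bsub>A\<^esub> S) S" using S by (simp add: A.sup_is_lub)
  then show "is_lub B (f (\<Squnion>\<^bsub>A\<^esub> S)) (f ` S)"
    unfolding is_lub_iff[OF fS] is_lub_iff[OF S]
    using S by (simp add: carrier_image le_iff subset_iff)
qed

lemma iso_frame_hom: "frame_hom A B f"
  using A.kappa_frame_axioms B.kappa_frame_axioms
  by (intro frame_homI) (simp_all add: iso_top iso_meet iso_sup)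

lemma iso_frame_isomorphic: "frame_isomorphic A B"
  unfolding frame_isomorphic_def using iso_frame_hom bij by blast

lemma inverse_iso: "frame_order_iso B A (inv_into (carrier A) f)"
proof (intro frame_order_iso.intro frame_order_iso_axioms.intro)
  show "bij_betw (inv_into (carrier A) f) (carrier B) (carrier A)"
    using bij by (rule bij_betw_inv_into)
  show "inv_into (carrier A) f x \<sqsubseteq>\<^bsub>A\<^esub> inv_into (carrier A) f y \<longleftrightarrow> x \<sqsubseteq>\<^bsub>B\<^esub> y"
    if "x \<in> carrier B" "y \<in> carrier B" for x y
    using that bij le_iff[of "inv_into (carrier A) f x" "inv_into (carrier A) f y"]
    by (simp add: carrier_image inv_into_into f_inv_into_f)
qed (rule B.kappa_frame_axioms A.kappa_frame_axioms)+

lemma iso_Lindelof: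
  assumes a: "kappa_Lindelof \<kappa> A a"
  shows "kappa_Lindelof \<kappa> B (f a)"
  unfolding kappa_Lindelof_def
proof (intro conjI allI impI)
  have ac: "a \<in> carrier A" using a by (simp add: kappa_Lindelof_def)
  then show "f a \<in> carrier B" by simp
  fix S assume S: "S \<subseteq> carrier B" and le: "f a \<sqsubseteq>\<^bsub>B\<^esub> \<Squnion>\<^bsub>B\<^esub> S"
  obtain S' where S': "S' \<subseteq> carrier A" "S = f ` S'"
    using S unfolding carrier_image by (meson subset_imageE)
  have "a \<sqsubseteq>\<^bsub>A\<^esub> \<Squnion>\<^bsub>A\<^esub> S'"
    using le S' ac by (simp add: iso_sup[symmetric] le_iff)
  then obtain T where T: "T \<subseteq> S'" "kappa_set \<kappa> T" "a \<sqsubseteq>\<^bsub>A\<^esub> \<Squnion>\<^bsub>A\<^esub> T"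
    using a S'(1) unfolding kappa_Lindelof_def by meson
  have Tc: "T \<subseteq> carrier A" using T(1) S'(1) by blast
  then have "f a \<sqsubseteq>\<^bsub>B\<^esub> \<Squnion>\<^bsub>B\<^esub> (f ` T)"
    using T(3) ac by (simp add: iso_sup[symmetric] le_iff)
  moreover have "f ` T \<subseteq> S" "kappa_set \<kappa> (f ` T)" using T S' by (auto simp: kappa_set_image)
  ultimately show "\<exists>T\<subseteq>S. kappa_set \<kappa> T \<and> f a \<sqsubseteq>\<^bsub>B\<^esub> \<Squnion>\<^bsub>B\<^esub> T" by (intro exI[of _ "f ` T"] conjI)
qed

lemma Lindelof_image: "{b. kappa_Lindelof \<kappa> B b} = f ` {a. kappa_Lindelof \<kappa> A a}"
proof
  interpret inv: frame_order_iso B A "inv_into (carrier A) f" by (rule inverse_iso)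
  show "f ` {a. kappa_Lindelof \<kappa> A a} \<subseteq> {b. kappa_Lindelof \<kappa> B b}"
    using iso_Lindelof by blast
  show "{b. kappa_Lindelof \<kappa> B b} \<subseteq> f ` {a. kappa_Lindelof \<kappa> A a}"
  proof
    fix b assume "b \<in> {b. kappa_Lindelof \<kappa> B b}"
    then have b: "kappa_Lindelof \<kappa> B b" by simp
    then have "b = f (inv_into (carrier A) f b)"
      by (simp add: kappa_Lindelof_def carrier_image f_inv_into_f)
    then show "b \<in> f ` {a. kappa_Lindelof \<kappa> A a}" using inv.iso_Lindelof[OF b] by blast
  qed
qed

lemma iso_coherent:
  assumes "kappa_coherent \<kappa> A"
  shows "kappa_coherent \<kappa> B"
proof -
  let ?K = "{a. kappa_Lindelof \<kappa> A a}"
  have K: "sub_kappa_frame \<kappa> ?K A" and gen: "\<forall>a\<in>carrier A. \<exists>S\<subseteq>?K. a = \<Squnion>\<^bsub>A\<^esub> S"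
    using assms by (simp_all add: kappa_coherent_def)
  have Kc: "?K \<subseteq> carrier A" by (auto simp: kappa_Lindelof_def)
  have "sub_kappa_frame \<kappa> (f ` ?K) B"
    unfolding sub_kappa_frame_def
  proof (intro conjI ballI allI impI)
    show "f ` ?K \<subseteq> carrier B" using Kc by auto
    show "\<top>\<^bsub>B\<^esub> \<in> f ` ?K"
      using K unfolding sub_kappa_frame_def iso_top[symmetric] by blast
    show "x \<sqinter>\<^bsub>B\<^esub> y \<in> f ` ?K" if xy: "x \<in> f ` ?K" "y \<in> f ` ?K" for x y
    proof -
      obtain a b where ab: "x = f a" "a \<in> ?K" "y = f b" "b \<in> ?K" using xy by blast
      then have "f (a \<sqinter>\<^bsub>A\<^esub> b) \<in> f ` ?K" using K unfolding sub_kappa_frame_def by blast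
      moreover have "a \<in> carrier A" "b \<in> carrier A" using ab Kc by auto
      ultimately show ?thesis using ab by (simp add: iso_meet)
    qed
    show "\<Squnion>\<^bsub>B\<^esub> S \<in> f ` ?K" if S: "S \<subseteq> f ` ?K" "kappa_set \<kappa> S" for S
    proof -
      have inv: "inv_into ?K f ` S \<subseteq> ?K" using S(1) inv_into_into[of _ f ?K] by blast
      then have "f (\<Squnion>\<^bsub>A\<^esub> (inv_into ?K f ` S)) \<in> f ` ?K"
        using K kappa_set_image[OF S(2)] unfolding sub_kappa_frame_def by blast
      moreover have "f ` inv_into ?K f ` S = S"
        using S(1) by (rule image_inv_into_cancel[OF refl])
      ultimately show ?thesis using inv Kc by (simp add: iso_sup subset_trans)
    qed
  qed
  moreover have "\<exists>S\<subseteq>f ` ?K. b = \<Squnion>\<^bsub>B\<^esub> S" if "b \<in> carrier B" for b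
  proof -
    obtain a where a: "a \<in> carrier A" "b = f a" using \<open>b \<in> carrier B\<close> unfolding carrier_image by blast
    then obtain S where S: "S \<subseteq> ?K" "a = \<Squnion>\<^bsub>A\<^esub> S" using gen by blast
    then have "b = \<Squnion>\<^bsub>B\<^esub> (f ` S)" using a Kc by (simp add: iso_sup subset_trans)
    then show ?thesis using S(1) by blast
  qed
  ultimately show ?thesis
    using B.kappa_frame_axioms by (simp add: kappa_coherent_def Lindelof_image)
qed

end

context regular_kappa_frame
begin

interpretation H: regular_kappa_frame infty "ideal_frame \<kappa> L"
  by (rule ideal_frame_regular)

text \<open>
  An ideal \<open>I\<close> is covered by the principal ideals of its elements; a \<open>\<kappa>\<close>-subcover has its join below
  \<open>\<down>s\<close>, where \<open>s\<close> is a \<open>\<kappa>\<close>-join of elements of \<open>I\<close> and so belongs to \<open>I\<close>. Conversely, if a join of ideals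
  contains \<open>a\<close>, then \<open>a\<close> lies below the join of a \<open>\<kappa>\<close>-set of elements, each taken from one of the ideals.
\<close>

lemma Lindelof_ideal_iff: "kappa_Lindelof \<kappa> (ideal_frame \<kappa> L) I \<longleftrightarrow> I \<in> principal L ` carrier L"
proof
  assume lind: "kappa_Lindelof \<kappa> (ideal_frame \<kappa> L) I"
  then have I: "kappa_ideal \<kappa> L I" by (simp add: kappa_Lindelof_def carrier_ideal_frame)
  have c: "I \<subseteq> carrier L" by (rule kappa_ideal_subset[OF I])
  have "principal L ` I \<subseteq> carrier (ideal_frame \<kappa> L)"
    using c kappa_ideal_principal by (auto simp: carrier_ideal_frame)
  then have "\<exists>\<T>\<subseteq>principal L ` I. kappa_set \<kappa> \<T> \<and> I \<subseteq> \<Squnion>\<^bsub>ideal_frame \<kappa> L\<^esub> \<T>"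
    using lind ideal_eq_sup_principal[OF I] unfolding kappa_Lindelof_def le_ideal_frame by blast
  then obtain \<T> where \<T>: "\<T> \<subseteq> principal L ` I" "kappa_set \<kappa> \<T>" "I \<subseteq> \<Squnion>\<^bsub>ideal_frame \<kappa> L\<^esub> \<T>"
    by blast
  define T where "T = inv_into I (principal L) ` \<T>"
  have T: "T \<subseteq> I" "kappa_set \<kappa> T" "principal L ` T = \<T>"
    using \<T>(1) inv_into_into[of _ "principal L" I] kappa_set_image[OF \<T>(2)]
      image_inv_into_cancel[OF HOL.refl \<T>(1)]
    unfolding T_def by auto
  have Tc: "T \<subseteq> carrier L" using T(1) c by blast
  have "\<Squnion>T \<in> I" using kappa_ideal_sup[OF I T(1,2)] .
  moreover have "I \<subseteq> principal L (\<Squnion>T)" using \<T>(3) principal_sup[OF Tc T(2)] T(3) by simp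
  ultimately have "I = principal L (\<Squnion>T)" "\<Squnion>T \<in> carrier L"
    using principal_subset_iff[OF I, of "\<Squnion>T"] c by auto
  then show "I \<in> principal L ` carrier L" by blast
next
  assume "I \<in> principal L ` carrier L"
  then obtain a where a: "a \<in> carrier L" "I = principal L a" by blast
  show "kappa_Lindelof \<kappa> (ideal_frame \<kappa> L) I"
    unfolding kappa_Lindelof_def le_ideal_frame
  proof (intro conjI allI impI)
    show "I \<in> carrier (ideal_frame \<kappa> L)" using a by (simp add: carrier_ideal_frame kappa_ideal_principal)
    fix \<S> assume \<S>: "\<S> \<subseteq> carrier (ideal_frame \<kappa> L)" and le: "I \<subseteq> \<Squnion>\<^bsub>ideal_frame \<kappa> L\<^esub> \<S>"
    have \<S>': "\<S> \<subseteq> {I. kappa_ideal \<kappa> L I}" using \<S> by (simp add: carrier_ideal_frame)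
    have "a \<in> \<Squnion>\<^bsub>ideal_frame \<kappa> L\<^esub> \<S>" using le a by (auto simp: principal_iff)
    then obtain T where T: "T \<subseteq> \<Union>\<S>" "kappa_set \<kappa> T" "a \<sqsubseteq> \<Squnion>T"
      unfolding ideal_frame_sup[OF \<S>'] by blast
    have "\<forall>t\<in>T. \<exists>J\<in>\<S>. t \<in> J" using T(1) by blast
    then obtain J where J: "\<And>t. t \<in> T \<Longrightarrow> J t \<in> \<S> \<and> t \<in> J t" by metis
    have JS: "J ` T \<subseteq> \<S>" and JT: "T \<subseteq> \<Union>(J ` T)" using J by auto
    have J': "J ` T \<subseteq> {I. kappa_ideal \<kappa> L I}" using JS \<S>' by blast
    have "a \<in> \<Squnion>\<^bsub>ideal_frame \<kappa> L\<^esub> (J ` T)"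
      unfolding ideal_frame_sup[OF J'] using a(1) JT T(2,3) by (intro CollectI conjI exI[of _ T])
    moreover have "kappa_ideal \<kappa> L (\<Squnion>\<^bsub>ideal_frame \<kappa> L\<^esub> (J ` T))"
      using H.sup_closed[of "J ` T"] J' by (simp add: carrier_ideal_frame)
    ultimately have "I \<subseteq> \<Squnion>\<^bsub>ideal_frame \<kappa> L\<^esub> (J ` T)"
      using principal_subset_iff[OF _ a(1)] a(2) by blast
    then show "\<exists>\<T>\<subseteq>\<S>. kappa_set \<kappa> \<T> \<and> I \<subseteq> \<Squnion>\<^bsub>ideal_frame \<kappa> L\<^esub> \<T>"
      using JS kappa_set_image[OF T(2)] by blast
  qed
qed

lemma ideal_frame_coherent: "kappa_coherent \<kappa> (ideal_frame \<kappa> L)"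
proof -
  have K: "{I. kappa_Lindelof \<kappa> (ideal_frame \<kappa> L) I} = principal L ` carrier L"
    by (auto simp: Lindelof_ideal_iff)
  have "sub_kappa_frame \<kappa> (principal L ` carrier L) (ideal_frame \<kappa> L)"
    unfolding sub_kappa_frame_def
  proof (intro conjI ballI allI impI)
    show "principal L ` carrier L \<subseteq> carrier (ideal_frame \<kappa> L)"
      using kappa_ideal_principal by (auto simp: carrier_ideal_frame)
    show "\<top>\<^bsub>ideal_frame \<kappa> L\<^esub> \<in> principal L ` carrier L"
      using principal_top by (auto simp: ideal_frame_top)
    show "I \<sqinter>\<^bsub>ideal_frame \<kappa> L\<^esub> J \<in> principal L ` carrier L"
      if "I \<in> principal L ` carrier L" "J \<in> principal L ` carrier L" for I J
      using that by (auto simp: ideal_frame_meet kappa_ideal_principal principal_meet[symmetric])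
    show "\<Squnion>\<^bsub>ideal_frame \<kappa> L\<^esub> \<S> \<in> principal L ` carrier L"
      if \<S>: "\<S> \<subseteq> principal L ` carrier L" "kappa_set \<kappa> \<S>" for \<S>
    proof -
      define T where "T = inv_into (carrier L) (principal L) ` \<S>"
      have T: "T \<subseteq> carrier L" "kappa_set \<kappa> T" "principal L ` T = \<S>"
        using \<S>(1) inv_into_into[of _ "principal L" "carrier L"] kappa_set_image[OF \<S>(2)]
          image_inv_into_cancel[OF HOL.refl \<S>(1)]
        unfolding T_def by auto
      then show ?thesis using principal_sup[OF T(1,2)] by simp
    qed
  qed
  moreover have "\<exists>\<S>\<subseteq>principal L ` carrier L. I = \<Squnion>\<^bsub>ideal_frame \<kappa> L\<^esub> \<S>"
    if "I \<in> carrier (ideal_frame \<kappa> L)" for I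
  proof -
    have I: "kappa_ideal \<kappa> L I" using that by (simp add: carrier_ideal_frame)
    show ?thesis
      using ideal_eq_sup_principal[OF I] kappa_ideal_subset[OF I]
      by (intro exI[of _ "principal L ` I"]) auto
  qed
  ultimately show ?thesis
    using ideal_frame_frame by (simp add: kappa_coherent_def K)
qed

end

section \<open>Ideals of a quotient\<close>

context kappa_frame_with_congruence
begin

abbreviation K where "K \<equiv> ideal_congruence \<kappa> L C"

interpretation H: kappa_frame_with_congruence infty "ideal_frame \<kappa> L" K
  using ideal_congruence_congruence[OF congruence]
  by (intro kappa_frame_with_congruence.intro ideal_frame_regular
      kappa_frame_with_congruence_axioms.intro)

lemma Union_quotient_ideal:
  assumes X: "kappa_ideal \<kappa> Q X"
  shows "x \<in> \<Union>X \<longleftrightarrow> x \<in> carrier L \<and> q x \<in> X"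
proof
  assume "x \<in> \<Union>X"
  then obtain Z where Z: "x \<in> Z" "Z \<in> X" by blast
  then obtain z where z: "z \<in> carrier L" "Z = q z"
    using kappa_ideal_subset[OF X] unfolding carrier_quotient by blast
  then have zx: "(z, x) \<in> C" using Z(1) by (simp add: mem_quotient_map)
  then have x: "x \<in> carrier L" using cong_carrier by blast
  then have "q z = q x" using zx by (simp add: quotient_map_eq_iff)
  then show "x \<in> carrier L \<and> q x \<in> X" using x z Z(2) by simp
next
  assume "x \<in> carrier L \<and> q x \<in> X"
  then show "x \<in> \<Union>X" using cong_refl[of x] mem_quotient_map by blast
qed

lemma kappa_ideal_Union:
  assumes X: "kappa_ideal \<kappa> Q X"
  shows "kappa_ideal \<kappa> L (\<Union>X)"
  unfolding kappa_ideal_def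
proof (intro conjI ballI allI impI)
  note U = Union_quotient_ideal[OF X]
  show "\<Union>X \<subseteq> carrier L" using U by blast
  show "y \<in> \<Union>X" if "x \<in> \<Union>X" "y \<in> carrier L" "y \<sqsubseteq> x" for x y
    using that kappa_ideal_down[OF X, of "q x" "q y"] unfolding U by (simp add: quotient_map_mono)
  show "\<Squnion>T \<in> \<Union>X" if T: "T \<subseteq> \<Union>X" "kappa_set \<kappa> T" for T
  proof -
    have c: "T \<subseteq> carrier L" and "q ` T \<subseteq> X" using T(1) U by blast+
    then have "\<Squnion>\<^bsub>Q\<^esub> (q ` T) \<in> X" using T(2) by (intro kappa_ideal_sup[OF X] kappa_set_image)
    then show ?thesis using c T(2) unfolding U by (simp add: quotient_map_sup)
  qed
qed

lemma kappa_ideal_quotient_image: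
  assumes I: "kappa_ideal \<kappa> L I"
  shows "kappa_ideal \<kappa> Q (q ` I)"
  unfolding kappa_ideal_def
proof (intro conjI ballI allI impI)
  have c: "I \<subseteq> carrier L" by (rule kappa_ideal_subset[OF I])
  then show "q ` I \<subseteq> carrier Q" by auto
  show "y \<in> q ` I" if xy: "x \<in> q ` I" "y \<in> carrier Q" "y \<sqsubseteq>\<^bsub>Q\<^esub> x" for x y
  proof -
    obtain a b where ab: "a \<in> I" "x = q a" "b \<in> carrier L" "y = q b"
      using xy(1,2) unfolding carrier_quotient by blast
    have ac: "a \<in> carrier L" using ab(1) c by blast
    have "(b \<sqinter> a, b) \<in> C" using xy(3) ab ac by (simp add: quotient_le_iff)
    then have "q (b \<sqinter> a) = y" using ab by (simp add: quotient_map_eq_iff)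
    moreover have "b \<sqinter> a \<in> I" using kappa_ideal_meet[OF I ab(1,3)] by simp
    ultimately show ?thesis by blast
  qed
  show "\<Squnion>\<^bsub>Q\<^esub> \<S> \<in> q ` I" if \<S>: "\<S> \<subseteq> q ` I" "kappa_set \<kappa> \<S>" for \<S>
  proof -
    obtain T where T: "T \<subseteq> I" "kappa_set \<kappa> T" "\<S> = q ` T"
      using quotient_kappa_set_rep[OF \<S>] by metis
    then have "q (\<Squnion>T) = \<Squnion>\<^bsub>Q\<^esub> \<S>" using c by (simp add: quotient_map_sup subset_trans)
    moreover have "\<Squnion>T \<in> I" using kappa_ideal_sup[OF I T(1,2)] .
    ultimately show ?thesis by (metis imageI)
  qed
qed

lemma Union_quotient_image: "\<Union>(q ` I) = C `` I"
  by (auto simp: quotient_map_def)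

lemma saturation_idem: "I \<subseteq> carrier L \<Longrightarrow> C `` (C `` I) = C `` I"
  using cong_trans cong_refl cong_carrier by blast

lemma saturation_ideal_congruence:
  assumes I: "kappa_ideal \<kappa> L I"
  shows "(C `` I, I) \<in> K"
  using kappa_ideal_Union[OF kappa_ideal_quotient_image[OF I]] saturation_idem[OF kappa_ideal_subset[OF I]] I
  by (simp add: ideal_congruence_def Union_quotient_image)

text \<open>
  Unions of ideals of classes are saturated, and on saturated ideals the order of the quotient is plain
  inclusion; surjectivity holds because each ideal is congruent to its saturation.
\<close>

lemma ideal_quotient_iso:
  "frame_order_iso (ideal_frame \<kappa> Q) (quotient_lattice (ideal_frame \<kappa> L) K)
    (\<lambda>X. quotient_map K (\<Union>X))"
proof (intro frame_order_iso.intro frame_order_iso_axioms.intro)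
  let ?A = "ideal_frame \<kappa> Q" and ?B = "quotient_lattice (ideal_frame \<kappa> L) K"
  let ?f = "\<lambda>X. quotient_map K (\<Union>X)"
  show A: "frame ?A" by (rule Q.ideal_frame_frame)
  show "frame ?B" by (rule H.quotient_kappa_frame)
  have Uc: "\<Union>X \<in> carrier (ideal_frame \<kappa> L)" if "X \<in> carrier ?A" for X
    using that kappa_ideal_Union by (simp add: carrier_ideal_frame)
  have sat: "C `` (\<Union>X) = \<Union>X" if "X \<in> carrier ?A" for X
  proof -
    have X: "kappa_ideal \<kappa> Q X" using that by (simp add: carrier_ideal_frame)
    have "q ` \<Union>X = X"
    proof
      show "q ` \<Union>X \<subseteq> X" using Union_quotient_ideal[OF X] by blast
      show "X \<subseteq> q ` \<Union>X"
      proof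
        fix Z assume "Z \<in> X"
        then obtain z where "z \<in> carrier L" "Z = q z"
          using kappa_ideal_subset[OF X] unfolding carrier_quotient by blast
        then show "Z \<in> q ` \<Union>X" using \<open>Z \<in> X\<close> Union_quotient_ideal[OF X] by blast
      qed
    qed
    then show ?thesis by (metis Union_quotient_image)
  qed
  show le: "?f X \<sqsubseteq>\<^bsub>?B\<^esub> ?f Y \<longleftrightarrow> X \<sqsubseteq>\<^bsub>?A\<^esub> Y" if XY: "X \<in> carrier ?A" "Y \<in> carrier ?A" for X Y
  proof -
    have X: "kappa_ideal \<kappa> Q X" and Y: "kappa_ideal \<kappa> Q Y"
      using XY by (simp_all add: carrier_ideal_frame)
    note UX = kappa_ideal_Union[OF X] and UY = kappa_ideal_Union[OF Y]
    have "?f X \<sqsubseteq>\<^bsub>?B\<^esub> ?f Y \<longleftrightarrow> (\<Union>X \<inter> \<Union>Y, \<Union>X) \<in> K"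
      using H.quotient_le_iff[OF Uc[OF XY(1)] Uc[OF XY(2)]] ideal_frame_meet[OF UX UY] by simp
    also have "\<dots> \<longleftrightarrow> \<Union>X \<subseteq> \<Union>Y"
    proof
      assume "(\<Union>X \<inter> \<Union>Y, \<Union>X) \<in> K"
      then have "C `` (\<Union>X) = C `` (\<Union>X \<inter> \<Union>Y)" by (simp add: ideal_congruence_def)
      also have "\<dots> \<subseteq> C `` (\<Union>Y)" by blast
      finally show "\<Union>X \<subseteq> \<Union>Y" using sat XY by simp
    next
      assume "\<Union>X \<subseteq> \<Union>Y"
      then have "\<Union>X \<inter> \<Union>Y = \<Union>X" by blast
      then show "(\<Union>X \<inter> \<Union>Y, \<Union>X) \<in> K" using UX by (simp add: ideal_congruence_def)
    qed
    also have "\<dots> \<longleftrightarrow> X \<subseteq> Y"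
    proof
      assume sub: "\<Union>X \<subseteq> \<Union>Y"
      show "X \<subseteq> Y"
      proof
        fix Z assume Z: "Z \<in> X"
        then obtain z where z: "z \<in> carrier L" "Z = q z"
          using kappa_ideal_subset[OF X] unfolding carrier_quotient by blast
        then have "z \<in> \<Union>Y" using Z sub Union_quotient_ideal[OF X] by blast
        then show "Z \<in> Y" using z Union_quotient_ideal[OF Y] by blast
      qed
    qed blast
    finally show ?thesis by (simp add: le_ideal_frame)
  qed
  show "bij_betw ?f (carrier ?A) (carrier ?B)"
    unfolding bij_betw_def
  proof
    show "inj_on ?f (carrier ?A)"
    proof (rule inj_onI)
      fix X Y assume XY: "X \<in> carrier ?A" "Y \<in> carrier ?A" "?f X = ?f Y"
      have "?f X \<sqsubseteq>\<^bsub>?B\<^esub> ?f X" using le[OF XY(1,1)] by (simp add: le_ideal_frame)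
      then have "X \<subseteq> Y" "Y \<subseteq> X"
        using le[OF XY(1,2)] le[OF XY(2,1)] XY(3) by (simp_all add: le_ideal_frame)
      then show "X = Y" by blast
    qed
    show "?f ` carrier ?A = carrier ?B"
    proof
      show "?f ` carrier ?A \<subseteq> carrier ?B" using Uc by auto
      show "carrier ?B \<subseteq> ?f ` carrier ?A"
      proof
        fix Z assume "Z \<in> carrier ?B"
        then obtain I where I: "kappa_ideal \<kappa> L I" "Z = quotient_map K I"
          unfolding H.carrier_quotient carrier_ideal_frame by blast
        have "?f (q ` I) = Z"
          using saturation_ideal_congruence[OF I(1)] I
          by (simp add: Union_quotient_image H.quotient_map_eq_iff carrier_ideal_frame)
        moreover have "q ` I \<in> carrier ?A"
          using kappa_ideal_quotient_image[OF I(1)] by (simp add: carrier_ideal_frame)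
        ultimately show "Z \<in> ?f ` carrier ?A" by blast
      qed
    qed
  qed
qed

lemma principal_quotient:
  assumes a: "a \<in> carrier L"
  shows "principal Q (q a) = q ` principal L a"
proof
  show "q ` principal L a \<subseteq> principal Q (q a)"
    using a by (auto simp: principal_def quotient_map_mono)
  show "principal Q (q a) \<subseteq> q ` principal L a"
  proof
    fix Z assume "Z \<in> principal Q (q a)"
    then obtain z where z: "z \<in> carrier L" "Z = q z" "q z \<sqsubseteq>\<^bsub>Q\<^esub> q a"
      unfolding principal_def carrier_quotient by blast
    then have "q (z \<sqinter> a) = Z" using a by (simp add: quotient_le_iff quotient_map_eq_iff)
    moreover have "z \<sqinter> a \<in> principal L a" using z a by (simp add: principal_iff meet_right)
    ultimately show "Z \<in> q ` principal L a" by blast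
  qed
qed

lemma quotient_map_proper:
  "kappa_proper \<kappa> (ideal_frame \<kappa> L) (quotient_lattice (ideal_frame \<kappa> L) K) (quotient_map K)"
  unfolding kappa_proper_def
proof (intro conjI allI impI)
  interpret iso: frame_order_iso "ideal_frame \<kappa> Q" "quotient_lattice (ideal_frame \<kappa> L) K"
    "\<lambda>X. quotient_map K (\<Union>X)"
    by (rule ideal_quotient_iso)
  show "kappa_coherent \<kappa> (ideal_frame \<kappa> L)" by (rule ideal_frame_coherent)
  show "kappa_coherent \<kappa> (quotient_lattice (ideal_frame \<kappa> L) K)"
    by (rule iso.iso_coherent[OF Q.ideal_frame_coherent])
  show "frame_hom (ideal_frame \<kappa> L) (quotient_lattice (ideal_frame \<kappa> L) K) (quotient_map K)"
    by (rule quotient_map_frame_hom[OF ideal_frame_frame H.congruence])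
  fix I assume "kappa_Lindelof \<kappa> (ideal_frame \<kappa> L) I"
  then obtain a where a: "a \<in> carrier L" "I = principal L a"
    unfolding Lindelof_ideal_iff by blast
  then have "kappa_Lindelof \<kappa> (ideal_frame \<kappa> Q) (principal Q (q a))"
    by (simp add: Q.Lindelof_ideal_iff)
  then have "kappa_Lindelof \<kappa> (quotient_lattice (ideal_frame \<kappa> L) K) (quotient_map K (\<Union>(principal Q (q a))))"
    by (rule iso.iso_Lindelof)
  \<comment> \<open>The union of the classes below the class of \<open>a\<close> is the saturation of \<open>\<down>a\<close>.\<close>
  moreover have "quotient_map K (\<Union>(principal Q (q a))) = quotient_map K I"
    using saturation_ideal_congruence[of I] a kappa_ideal_principal[OF a(1)]
    by (simp add: principal_quotient Union_quotient_image H.quotient_map_eq_iff carrier_ideal_frame)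
  ultimately show "kappa_Lindelof \<kappa> (quotient_lattice (ideal_frame \<kappa> L) K) (quotient_map K I)" by simp
qed

end

theorem mainTheorem18:
  fixes \<kappa> :: "'k rel option" and L :: "('a, 'b) gorder_scheme"
  assumes "regular_or_infty \<kappa>"
    and "kappa_frame \<kappa> L"
  shows "frame_hom (congruence_frame \<kappa> L) (congruence_frame infty (ideal_frame \<kappa> L))
           (cong_embedding \<kappa> L)
       \<and> inj_on (cong_embedding \<kappa> L) (carrier (congruence_frame \<kappa> L))
       \<and> (\<forall>C \<in> carrier (congruence_frame \<kappa> L).
            frame_isomorphic (ideal_frame \<kappa> (quotient_lattice L C))
              (quotient_lattice (ideal_frame \<kappa> L) (cong_embedding \<kappa> L C))
          \<and> kappa_proper \<kappa> (ideal_frame \<kappa> L)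
              (quotient_lattice (ideal_frame \<kappa> L) (cong_embedding \<kappa> L C))
              (quotient_map (cong_embedding \<kappa> L C)))"
proof -
  interpret regular_kappa_frame \<kappa> L
    using assms by (intro regular_kappa_frame.intro regular_kappa_frame_axioms.intro)
  have "frame_isomorphic (ideal_frame \<kappa> (quotient_lattice L C))
          (quotient_lattice (ideal_frame \<kappa> L) (cong_embedding \<kappa> L C))
      \<and> kappa_proper \<kappa> (ideal_frame \<kappa> L)
          (quotient_lattice (ideal_frame \<kappa> L) (cong_embedding \<kappa> L C))
          (quotient_map (cong_embedding \<kappa> L C))"
    if "C \<in> carrier (congruence_frame \<kappa> L)" for C
  proof -
    have C: "kappa_congruence \<kappa> L C" using that by (simp add: congruence_frame_def)
    interpret kappa_frame_with_congruence \<kappa> L C by unfold_locales (rule C)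
    show ?thesis
      unfolding cong_embedding_eq[OF C]
      using frame_order_iso.iso_frame_isomorphic[OF ideal_quotient_iso] quotient_map_proper by blast
  qed
  then show ?thesis using cong_embedding_frame_hom cong_embedding_inj by blast
qed

end
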